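(* The sum of the interior angles of a geodesic triangle of $\widetilde{\mathrm{SL}_2(\mathbb R)}$ space can be greater than, less than, or equal to $\pi$. That is, there exist geodesic triangles in $\widetilde{\mathrm{SL}_2(\mathbb R)}$ with $\omega_1+\omega_2+\omega_3>\pi$, there exist geodesic triangles with $\omega_1+\omega_2+\omega_3<\pi$, and there exist geodesic triangles with $\omega_1+\omega_2+\omega_3=\pi$, where $\omega_1,\omega_2,\omega_3$ denote the interior angles.
   Context: Model of the space. Let $\mathcal H$ be the set of points $(x^0:x^1:x^2:x^3)$ (homogeneous coordinates up to positive multiples, i.e. points of the projective sphere) with $-x^0x^0-x^1x^1+x^2x^2+x^3x^3<0$. Normalizing this form to $-1$, points of $\mathcal H$ are parametrized by $x^0=\cosh r\cos\phi$, $x^1=\cosh r\sin\phi$, $x^2=\sinh r\cos(\theta-\phi)$, $x^3=\sinh r\sin(\theta-\phi)$, where $(r,\theta)$ are polar coordinates (of the base plane) and $\phi$ is the fibre coordinate. Letting $\phi$ range over all of $\mathbb R$ one obtains the universal cover $\widetilde{\mathcal H}$ of $\mathcal H$; with the Riemannian metric $$(ds)^2=(dr)^2+\cosh^2 r\,\sinh^2 r\,(d\theta)^2+\big[d\phi+\sinh^2 r\,d\theta\big]^2$$ this is the space $\widetilde{\mathrm{SL}_2(\mathbb R)}$. Geodesic triangles. Given three pairwise distinct points $A_1,A_2,A_3$ of $\widetilde{\mathrm{SL}_2(\mathbb R)}$ not lying on a common geodesic, a geodesic triangle with these vertices consists of geodesic segments of this Riemannian metric joining each pair of vertices (the sides).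 The interior angle $\omega_i\in[0,\pi]$ at $A_i$ is the Riemannian angle between the tangent vectors at $A_i$ of the two sides meeting at $A_i$, both oriented away from $A_i$. *)

theory Defs
  imports "HOL-Analysis.Analysis"
begin

section \<open>Geodesics and angles of a Riemannian metric on a coordinate space\<close>

text \<open>
  A Riemannian metric on \<open>real ^ 'n\<close> is given by \<open>G\<close>, where \<open>G p X Y\<close> is the inner product of the
  tangent vectors \<open>X\<close> and \<open>Y\<close> at the point \<open>p\<close>.
\<close>

type_synonym 'n metric = "real ^ 'n \<Rightarrow> real ^ 'n \<Rightarrow> real ^ 'n \<Rightarrow> real"

definition metric_matrix :: "'n::finite metric \<Rightarrow> real ^ 'n \<Rightarrow> real ^ 'n ^ 'n" where
  "metric_matrix G p = (\<chi> i j. G p (axis i 1) (axis j 1))"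

definition partial_deriv :: "'n::finite \<Rightarrow> (real ^ 'n \<Rightarrow> real) \<Rightarrow> real ^ 'n \<Rightarrow> real" where
  "partial_deriv i f p = deriv (\<lambda>h. f (p + h *\<^sub>R axis i 1)) 0"

definition christoffel :: "'n::finite metric \<Rightarrow> real ^ 'n \<Rightarrow> 'n \<Rightarrow> 'n \<Rightarrow> 'n \<Rightarrow> real" where
  "christoffel G p k i j =
     (1/2) * (\<Sum>l\<in>UNIV. matrix_inv (metric_matrix G p) $ k $ l *
        (partial_deriv i (\<lambda>q. metric_matrix G q $ j $ l) p
       + partial_deriv j (\<lambda>q. metric_matrix G q $ i $ l) p
       - partial_deriv l (\<lambda>q. metric_matrix G q $ i $ j) p))"

text \<open>
  Geodesics are the (affinely parametrized) solutions of the geodesic equation; at an endpoint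
  of \<open>I\<close> the derivatives are one-sided.
\<close>

definition geodesic_on :: "'n::finite metric \<Rightarrow> real set \<Rightarrow> (real \<Rightarrow> real ^ 'n) \<Rightarrow> bool" where
  "geodesic_on G I c \<longleftrightarrow> (\<exists>c' c''. \<forall>t\<in>I.
     (c has_vector_derivative c' t) (at t within I) \<and>
     (c' has_vector_derivative c'' t) (at t within I) \<and>
     (\<forall>k. c'' t $ k + (\<Sum>i\<in>UNIV. \<Sum>j\<in>UNIV. christoffel G (c t) k i j * c' t $ i * c' t $ j) = 0))"

definition geodesic_segment :: "'n::finite metric \<Rightarrow> real ^ 'n \<Rightarrow> real ^ 'n \<Rightarrow> (real \<Rightarrow> real ^ 'n) \<Rightarrow> bool" where
  "geodesic_segment G A B c \<longleftrightarrow> geodesic_on G {0..1} c \<and> pathstart c = A \<and> pathfinish c = B"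

definition on_common_geodesic :: "'n::finite metric \<Rightarrow> (real ^ 'n) set \<Rightarrow> bool" where
  "on_common_geodesic G S \<longleftrightarrow> (\<exists>a b c. a < b \<and> geodesic_on G {a..b} c \<and> S \<subseteq> c ` {a..b})"

definition geodesic_triangle ::
  "'n::finite metric \<Rightarrow> real ^ 'n \<Rightarrow> real ^ 'n \<Rightarrow> real ^ 'n \<Rightarrow>
   (real \<Rightarrow> real ^ 'n) \<Rightarrow> (real \<Rightarrow> real ^ 'n) \<Rightarrow> (real \<Rightarrow> real ^ 'n) \<Rightarrow> bool" where
  "geodesic_triangle G A1 A2 A3 c12 c23 c31 \<longleftrightarrow>
     A1 \<noteq> A2 \<and> A2 \<noteq> A3 \<and> A3 \<noteq> A1 \<and> \<not> on_common_geodesic G {A1, A2, A3} \<and>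
     geodesic_segment G A1 A2 c12 \<and> geodesic_segment G A2 A3 c23 \<and> geodesic_segment G A3 A1 c31"

definition riemannian_angle :: "'n::finite metric \<Rightarrow> real ^ 'n \<Rightarrow> real ^ 'n \<Rightarrow> real ^ 'n \<Rightarrow> real" where
  "riemannian_angle G p X Y = arccos (G p X Y / (sqrt (G p X X) * sqrt (G p Y Y)))"

definition initial_velocity :: "(real \<Rightarrow> real ^ 'n::finite) \<Rightarrow> real ^ 'n" where
  "initial_velocity c = vector_derivative c (at 0 within {0..1})"

text \<open>The angle between two sides starting at a common vertex:\<close>

definition angle_between :: "'n::finite metric \<Rightarrow> (real \<Rightarrow> real ^ 'n) \<Rightarrow> (real \<Rightarrow> real ^ 'n) \<Rightarrow> real" where
  "angle_between G c d = riemannian_angle G (pathstart c) (initial_velocity c) (initial_velocity d)"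

text \<open>The sides run cyclically, so at each vertex the incoming side has to be reversed.\<close>

definition interior_angle_sum ::
  "'n::finite metric \<Rightarrow> (real \<Rightarrow> real ^ 'n) \<Rightarrow> (real \<Rightarrow> real ^ 'n) \<Rightarrow> (real \<Rightarrow> real ^ 'n) \<Rightarrow> real" where
  "interior_angle_sum G c12 c23 c31 =
     angle_between G c12 (reversepath c31)
   + angle_between G c23 (reversepath c12)
   + angle_between G c31 (reversepath c23)"


section \<open>The universal cover of SL(2,R)\<close>

text \<open>
  The polar coordinates \<open>(r, \<theta>, \<phi>)\<close> are singular on the fibre \<open>r = 0\<close>. As global coordinates of
  the universal cover we use \<open>(u, v, \<phi>)\<close> with \<open>u = sinh r cos \<theta>\<close> and \<open>v = sinh r sin \<theta>\<close>, so that
  the underlying manifold is \<open>real ^ 3\<close>. The projection to the hyperboloid model is then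
  \<open>x\<^sup>0 + \<i> x\<^sup>1 = sqrt (1 + u\<^sup>2 + v\<^sup>2) exp (\<i> \<phi>)\<close>, \<open>x\<^sup>2 + \<i> x\<^sup>3 = (u + \<i> v) exp (-\<i> \<phi>)\<close>.
\<close>

definition sl2_polar :: "real \<Rightarrow> real \<Rightarrow> real \<Rightarrow> real ^ 3" where
  "sl2_polar r \<theta> \<phi> = vector [sinh r * cos \<theta>, sinh r * sin \<theta>, \<phi>]"

definition sl2_cover :: "real ^ 3 \<Rightarrow> real ^ 4" where
  "sl2_cover p = vector
     [sqrt (1 + (p$1)\<^sup>2 + (p$2)\<^sup>2) * cos (p$3),
      sqrt (1 + (p$1)\<^sup>2 + (p$2)\<^sup>2) * sin (p$3),
      p$1 * cos (p$3) + p$2 * sin (p$3),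
      p$2 * cos (p$3) - p$1 * sin (p$3)]"

text \<open>The 1-form \<open>\<alpha> = u dv - v du\<close>, which is \<open>sinh\<^sup>2 r d\<theta>\<close> in polar coordinates:\<close>

definition sl2_form :: "real ^ 3 \<Rightarrow> real ^ 3 \<Rightarrow> real" where
  "sl2_form p X = p$1 * X$2 - p$2 * X$1"

text \<open>
  With \<open>\<rho> = sinh r\<close>, the metric
  \<open>dr\<^sup>2 + cosh\<^sup>2 r sinh\<^sup>2 r d\<theta>\<^sup>2 + (d\<phi> + sinh\<^sup>2 r d\<theta>)\<^sup>2\<close> becomes
  \<open>(du\<^sup>2 + dv\<^sup>2 + (2 + \<rho>\<^sup>2) \<alpha>\<^sup>2) / (1 + \<rho>\<^sup>2) + (d\<phi> + \<alpha>)\<^sup>2\<close>, which is smooth also at \<open>r = 0\<close>;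
  see \<open>sl2_metric_polar\<close> below.
\<close>

definition sl2_metric :: "3 metric" where
  "sl2_metric p X Y =
     (X$1 * Y$1 + X$2 * Y$2 + (2 + (p$1)\<^sup>2 + (p$2)\<^sup>2) * sl2_form p X * sl2_form p Y)
       / (1 + (p$1)\<^sup>2 + (p$2)\<^sup>2)
     + (X$3 + sl2_form p X) * (Y$3 + sl2_form p Y)"


subsection \<open>Agreement with the coordinate description\<close>

lemma vector_4 [simp]:
  "(vector [a,b,c,d] :: real^4) $ 1 = a" "(vector [a,b,c,d] :: real^4) $ 2 = b"
  "(vector [a,b,c,d] :: real^4) $ 3 = c" "(vector [a,b,c,d] :: real^4) $ 4 = d"
  by (simp_all add: vector_def)

lemma sl2_cover_polar:
  "sl2_cover (sl2_polar r \<theta> \<phi>) =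
     vector [cosh r * cos \<phi>, cosh r * sin \<phi>, sinh r * cos (\<theta> - \<phi>), sinh r * sin (\<theta> - \<phi>)]"
proof -
  have "1 + (sinh r * cos \<theta>)\<^sup>2 + (sinh r * sin \<theta>)\<^sup>2 = 1 + (sinh r)\<^sup>2 * ((sin \<theta>)\<^sup>2 + (cos \<theta>)\<^sup>2)"
    by (simp only: power_mult_distrib distrib_left add_ac)
  also have "\<dots> = (cosh r)\<^sup>2"
    using cosh_square_eq[of r] by simp
  finally have "sqrt (1 + (sinh r * cos \<theta>)\<^sup>2 + (sinh r * sin \<theta>)\<^sup>2) = cosh r"
    by simp
  then show ?thesis
    by (simp add: sl2_cover_def sl2_polar_def cos_diff sin_diff algebra_simps)
qed

lemma sl2_polar_surj: "\<exists>r\<ge>0. \<exists>\<theta> \<phi>. p = sl2_polar r \<theta> \<phi>"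
proof -
  obtain \<rho> \<theta> where "\<rho> \<ge> 0" "p$1 = \<rho> * cos \<theta>" "p$2 = \<rho> * sin \<theta>"
  proof -
    have "Complex (p$1) (p$2) = rcis (cmod (Complex (p$1) (p$2))) (Arg (Complex (p$1) (p$2)))"
      by (simp add: rcis_cmod_Arg)
    then show ?thesis
      using that[of "cmod (Complex (p$1) (p$2))" "Arg (Complex (p$1) (p$2))"]
      by (metis Im_rcis Re_rcis complex.sel norm_ge_zero)
  qed
  then have "p = sl2_polar (arsinh \<rho>) \<theta> (p$3)"
    by (simp add: sl2_polar_def vec_eq_iff forall_3)
  moreover have "arsinh \<rho> \<ge> 0"
    using \<open>\<rho> \<ge> 0\<close> arsinh_less_iff_real[of \<rho> 0] unfolding arsinh_0 by linarith
  ultimately show ?thesis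
    by blast
qed

lemma range_sl2_cover:
  "range sl2_cover = {x. - (x$1)\<^sup>2 - (x$2)\<^sup>2 + (x$3)\<^sup>2 + (x$4)\<^sup>2 = -1}"
proof (intro subset_antisym subsetI)
  fix x assume "x \<in> range sl2_cover"
  then obtain p where x: "x = sl2_cover p" by blast
  define s where "s = sqrt (1 + (p$1)\<^sup>2 + (p$2)\<^sup>2)"
  have s: "s\<^sup>2 = 1 + (p$1)\<^sup>2 + (p$2)\<^sup>2"
    by (simp add: s_def)
  have "- (s * cos (p$3))\<^sup>2 - (s * sin (p$3))\<^sup>2 + (p$1 * cos (p$3) + p$2 * sin (p$3))\<^sup>2
         + (p$2 * cos (p$3) - p$1 * sin (p$3))\<^sup>2
        = (- s\<^sup>2 + (p$1)\<^sup>2 + (p$2)\<^sup>2) * ((sin (p$3))\<^sup>2 + (cos (p$3))\<^sup>2)"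
    by algebra
  then show "x \<in> {x. - (x$1)\<^sup>2 - (x$2)\<^sup>2 + (x$3)\<^sup>2 + (x$4)\<^sup>2 = -1}"
    by (simp add: x sl2_cover_def s flip: s_def)
next
  fix x :: "real^4" assume "x \<in> {x. - (x$1)\<^sup>2 - (x$2)\<^sup>2 + (x$3)\<^sup>2 + (x$4)\<^sup>2 = -1}"
  then have x: "(x$1)\<^sup>2 + (x$2)\<^sup>2 = 1 + (x$3)\<^sup>2 + (x$4)\<^sup>2"
    by simp
  define s where "s = cmod (Complex (x$1) (x$2))"
  define \<phi> where "\<phi> = Arg (Complex (x$1) (x$2))"
  have "Complex (x$1) (x$2) = rcis s \<phi>"
    by (simp add: rcis_cmod_Arg s_def \<phi>_def)
  then have x12: "x$1 = s * cos \<phi>" "x$2 = s * sin \<phi>"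
    by (metis Im_rcis Re_rcis complex.sel)+
  have s: "s = sqrt (1 + (x$3)\<^sup>2 + (x$4)\<^sup>2)"
    by (simp add: s_def cmod_def x)
  define u where "u = x$3 * cos \<phi> - x$4 * sin \<phi>"
  define v where "v = x$3 * sin \<phi> + x$4 * cos \<phi>"
  have sc: "(sin \<phi>)\<^sup>2 + (cos \<phi>)\<^sup>2 = 1" by simp
  have "u\<^sup>2 + v\<^sup>2 = (x$3)\<^sup>2 + (x$4)\<^sup>2" "u * cos \<phi> + v * sin \<phi> = x$3" "v * cos \<phi> - u * sin \<phi> = x$4"
    unfolding u_def v_def using sc by algebra+
  then have "x = sl2_cover (vector [u, v, \<phi>])"
    by (simp add: sl2_cover_def vec_eq_iff forall_4 x12 s add.assoc)
  then show "x \<in> range sl2_cover"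
    by blast
qed

lemma sl2_cover_eq_iff:
  "sl2_cover p = sl2_cover q \<longleftrightarrow>
     p$1 = q$1 \<and> p$2 = q$2 \<and> (\<exists>n::int. p$3 = q$3 + 2 * pi * of_int n)"
proof
  assume eq: "sl2_cover p = sl2_cover q"
  define s where "s = sqrt (1 + (p$1)\<^sup>2 + (p$2)\<^sup>2)"
  define t where "t = sqrt (1 + (q$1)\<^sup>2 + (q$2)\<^sup>2)"
  have pos: "s > 0" "t > 0"
    by (simp_all add: s_def t_def add_pos_nonneg)
  have e: "s * cos (p$3) = t * cos (q$3)" "s * sin (p$3) = t * sin (q$3)"
    "p$1 * cos (p$3) + p$2 * sin (p$3) = q$1 * cos (q$3) + q$2 * sin (q$3)"
    "p$2 * cos (p$3) - p$1 * sin (p$3) = q$2 * cos (q$3) - q$1 * sin (q$3)"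
    using eq by (simp_all add: sl2_cover_def vec_eq_iff forall_4 s_def t_def)
  have sc: "(sin (p$3))\<^sup>2 + (cos (p$3))\<^sup>2 = 1" "(sin (q$3))\<^sup>2 + (cos (q$3))\<^sup>2 = 1"
    by simp_all
  have "s\<^sup>2 = t\<^sup>2"
    using e(1,2) sc by algebra
  then have "s = t"
    using pos by simp
  then have cs: "cos (p$3) = cos (q$3)" "sin (p$3) = sin (q$3)"
    using e pos by auto
  moreover have "p$1 = q$1" "p$2 = q$2"
    using e(3,4) sc unfolding cs by algebra+
  ultimately show "p$1 = q$1 \<and> p$2 = q$2 \<and> (\<exists>n::int. p$3 = q$3 + 2 * pi * of_int n)"
    using sin_cos_eq_iff[of "p$3" "q$3"] by auto
next
  assume *: "p$1 = q$1 \<and> p$2 = q$2 \<and> (\<exists>n::int. p$3 = q$3 + 2 * pi * of_int n)"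
  then have "sin (p$3) = sin (q$3)" "cos (p$3) = cos (q$3)"
    using sin_cos_eq_iff[of "p$3" "q$3"] by auto
  then show "sl2_cover p = sl2_cover q"
    using * by (simp add: sl2_cover_def)
qed

lemma sl2_metric_polar:
  assumes "(r has_real_derivative r') (at t)" "(\<theta> has_real_derivative \<theta>') (at t)"
    and "(\<phi> has_real_derivative \<phi>') (at t)"
  obtains V where "((\<lambda>t. sl2_polar (r t) (\<theta> t) (\<phi> t)) has_vector_derivative V) (at t)"
    and "sl2_metric (sl2_polar (r t) (\<theta> t) (\<phi> t)) V V =
      r'\<^sup>2 + (cosh (r t))\<^sup>2 * (sinh (r t))\<^sup>2 * \<theta>'\<^sup>2 + (\<phi>' + (sinh (r t))\<^sup>2 * \<theta>')\<^sup>2"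
proof -
  define S where "S = sinh (r t)"
  define C where "C = cosh (r t)"
  define x where "x = cos (\<theta> t)"
  define y where "y = sin (\<theta> t)"
  define V :: "real^3" where "V = vector [C * r' * x - S * y * \<theta>', C * r' * y + S * x * \<theta>', \<phi>']"
  have "((\<lambda>t. sinh (r t) * cos (\<theta> t)) has_real_derivative C * r' * x - S * y * \<theta>') (at t)"
       "((\<lambda>t. sinh (r t) * sin (\<theta> t)) has_real_derivative C * r' * y + S * x * \<theta>') (at t)"
    by (auto intro!: derivative_eq_intros assms simp: S_def C_def x_def y_def)
  then have "((\<lambda>t. sl2_polar (r t) (\<theta> t) (\<phi> t) $ i) has_real_derivative V $ i) (at t)" for i
    using assms(3) exhaust_3[of i] by (auto simp: sl2_polar_def V_def)
  then have "((\<lambda>t. \<chi> i. sl2_polar (r t) (\<theta> t) (\<phi> t) $ i) has_vector_derivative (\<chi> i. V $ i)) (at t)"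
    unfolding has_vector_derivative_def has_field_derivative_def
    by (intro has_derivative_componentwise_within[THEN iffD2])
       (auto simp: Basis_vec_def inner_axis mult.commute[of _ "V $ _"])
  then have V: "((\<lambda>t. sl2_polar (r t) (\<theta> t) (\<phi> t)) has_vector_derivative V) (at t)"
    by simp
  have xy: "x\<^sup>2 + y\<^sup>2 = 1" and CS: "C\<^sup>2 = 1 + S\<^sup>2"
    using cosh_square_eq[of "r t"] by (simp_all add: x_def y_def C_def S_def)
  have form: "sl2_form (sl2_polar (r t) (\<theta> t) (\<phi> t)) V = S\<^sup>2 * \<theta>'"
  proof -
    have "S * x * (C * r' * y + S * x * \<theta>') - S * y * (C * r' * x - S * y * \<theta>') = S\<^sup>2 * \<theta>'"
      using xy by algebra
    then show ?thesis
      by (simp add: sl2_form_def sl2_polar_def V_def flip: S_def x_def y_def)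
  qed
  have rho: "(S * x)\<^sup>2 + (S * y)\<^sup>2 = S\<^sup>2"
    using xy by algebra
  have "1 + S\<^sup>2 > 0"
    by (simp add: add_pos_nonneg)
  have "(C * r' * x - S * y * \<theta>')\<^sup>2 + (C * r' * y + S * x * \<theta>')\<^sup>2 + (2 + S\<^sup>2) * (S\<^sup>2 * \<theta>')\<^sup>2
      = (1 + S\<^sup>2) * (r'\<^sup>2 + C\<^sup>2 * S\<^sup>2 * \<theta>'\<^sup>2)"
    using xy CS by algebra
  with \<open>1 + S\<^sup>2 > 0\<close> have eq:
    "((C * r' * x - S * y * \<theta>')\<^sup>2 + (C * r' * y + S * x * \<theta>')\<^sup>2 + (2 + S\<^sup>2) * (S\<^sup>2 * \<theta>')\<^sup>2) / (1 + S\<^sup>2)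
      = r'\<^sup>2 + C\<^sup>2 * S\<^sup>2 * \<theta>'\<^sup>2"
    by (simp add: field_simps)
  have "sl2_metric (sl2_polar (r t) (\<theta> t) (\<phi> t)) V V =
      ((C * r' * x - S * y * \<theta>')\<^sup>2 + (C * r' * y + S * x * \<theta>')\<^sup>2 + (2 + S\<^sup>2) * (S\<^sup>2 * \<theta>')\<^sup>2) / (1 + S\<^sup>2)
      + (\<phi>' + S\<^sup>2 * \<theta>')\<^sup>2"
    unfolding sl2_metric_def form
    by (simp add: sl2_polar_def V_def power2_eq_square mult.assoc add.assoc
          rho[unfolded power2_eq_square mult.assoc] flip: S_def x_def y_def)
  then show ?thesis
    using that[OF V] unfolding eq unfolding S_def C_def by blast
qed

lemma sl2_metric_sym: "sl2_metric p X Y = sl2_metric p Y X"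
  by (simp add: sl2_metric_def algebra_simps)

lemma sl2_metric_pos:
  assumes "X \<noteq> 0"
  shows "sl2_metric p X X > 0"
proof -
  define a where "a = sl2_form p X"
  define k where "k = (p$1)\<^sup>2 + (p$2)\<^sup>2"
  have k: "k \<ge> 0" by (simp add: k_def)
  have eq: "sl2_metric p X X = ((X$1)\<^sup>2 + (X$2)\<^sup>2 + (2 + k) * a\<^sup>2) / (1 + k) + (X$3 + a)\<^sup>2"
    by (simp add: sl2_metric_def a_def k_def power2_eq_square algebra_simps)
  show ?thesis
  proof (cases "X$1 = 0 \<and> X$2 = 0")
    case True
    then have "a = 0" "X$3 \<noteq> 0"
      using assms by (auto simp: a_def sl2_form_def vec_eq_iff forall_3)
    with True show ?thesis by (simp add: eq)
  next
    case False
    then have "(X$1)\<^sup>2 + (X$2)\<^sup>2 > 0"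
      by (simp add: sum_power2_gt_zero_iff)
    with k have "((X$1)\<^sup>2 + (X$2)\<^sup>2 + (2 + k) * a\<^sup>2) / (1 + k) > 0"
      by (intro divide_pos_pos add_pos_nonneg[of "(X$1)\<^sup>2 + (X$2)\<^sup>2"] mult_nonneg_nonneg) auto
    then show ?thesis
      by (simp add: eq add_pos_nonneg)
  qed
qed

end

theory Submission
  imports Defs
begin

text \<open>
  Three explicit triangles with a vertex at the origin are exhibited. The origin may be any point, as
  the space is homogeneous, and it makes two things easy. A geodesic through the origin and another
  point of height \<open>\<phi> = 0\<close> is a horizontal radius (\<open>geodesic_through_origin\<close>), so three points are not
  on a common geodesic as soon as one of the others has height 0 and the third one is off the radius
  through it. And the geodesics through the axis \<open>u = v = 0\<close> have a simple closed form.
  More generally all geodesics needed are orbits of one-parameter groups of isometries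
  (\<open>orbit_geodesic\<close>), so that the geodesic equation reduces to polynomial identities.

  \<^emph>\<open>Angle sum at least \<open>\<pi>\<close>.\<close> Two of the vertices lie on the axis and the third one elsewhere, joined to
  them by a horizontal radius and a helix that meet there at a right angle. On the axis these two sides
  have orthogonal directions \<open>X\<close> and \<open>Y\<close>, when tangent spaces along the axis are identified by
  translation. If \<open>h\<close> is the direction of the side joining the vertices on the axis, the two other
  angles are those between \<open>h\<close> and \<open>X\<close> and between \<open>h\<close> and \<open>Y\<close>. By the triangle inequality on the
  sphere they add up to at least a right angle, with equality when \<open>h\<close> lies on the great arc from \<open>X\<close>
  to \<open>Y\<close>. The axis itself is a possible side and gives a sum greater than \<open>\<pi>\<close>; but the two vertices are
  also joined by helices that wind around once, and the parameters are chosen so that one of these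
  starts on the great arc, which gives exactly \<open>\<pi>\<close>.

  \<^emph>\<open>Angle sum below \<open>\<pi>\<close>.\<close> A nearly horizontal triangle feels the negative curvature of the horizontal
  planes. Two horizontal radii from the origin form the legs of an isosceles triangle whose base is a
  geodesic with both ends at height 0 (\<open>arch_geodesic\<close>); the symmetry gives the base angle in
  closed form.
\<close>

section \<open>The geodesic equation\<close>

text \<open>
  The right-hand side of the geodesic equation solved for the second derivative. With the fibre
  component \<open>C = X$3 + \<alpha>\<close> of the velocity, the abbreviation \<open>B\<close> is \<open>C + \<alpha>\<close>, and \<open>k\<close> is half of the
  logarithmic derivative of \<open>K\<close> in the direction \<open>X\<close>.
\<close>

definition sl2_accel :: "real ^ 3 \<Rightarrow> real ^ 3 \<Rightarrow> real ^ 3" where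
  "sl2_accel p X =
    (let K = 1 + (p$1)\<^sup>2 + (p$2)\<^sup>2; \<alpha> = sl2_form p X; B = X$3 + 2 * \<alpha>;
         k = (p$1 * X$1 + p$2 * X$2) / K
     in vector
       [(\<alpha> + 2 * K * B) * X$2 + k * (X$1 - p$2 * (\<alpha> + 2 * (K + 1) * B)),
        - (\<alpha> + 2 * K * B) * X$1 + k * (X$2 + p$1 * (\<alpha> + 2 * (K + 1) * B)),
        2 * k * B])"

lemma metric_matrix_entries:
  fixes q :: "real ^ 3"
  defines "I \<equiv> inverse (1 + (q$1)\<^sup>2 + (q$2)\<^sup>2)"
  shows "metric_matrix sl2_metric q $ 1 $ 1 = I + (q$2)\<^sup>2 * (2 + I)"
    and "metric_matrix sl2_metric q $ 2 $ 2 = I + (q$1)\<^sup>2 * (2 + I)"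
    and "metric_matrix sl2_metric q $ 1 $ 2 = - (q$1 * q$2 * (2 + I))"
    and "metric_matrix sl2_metric q $ 2 $ 1 = - (q$1 * q$2 * (2 + I))"
    and "metric_matrix sl2_metric q $ 1 $ 3 = - (q$2)"
    and "metric_matrix sl2_metric q $ 3 $ 1 = - (q$2)"
    and "metric_matrix sl2_metric q $ 2 $ 3 = q$1"
    and "metric_matrix sl2_metric q $ 3 $ 2 = q$1"
    and "metric_matrix sl2_metric q $ 3 $ 3 = 1"
proof -
  have pos: "1 + (q$1)\<^sup>2 + (q$2)\<^sup>2 \<noteq> 0" by (smt (verit) zero_le_power2)
  show "metric_matrix sl2_metric q $ 1 $ 1 = I + (q$2)\<^sup>2 * (2 + I)"
    "metric_matrix sl2_metric q $ 2 $ 2 = I + (q$1)\<^sup>2 * (2 + I)"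
    "metric_matrix sl2_metric q $ 1 $ 2 = - (q$1 * q$2 * (2 + I))"
    "metric_matrix sl2_metric q $ 2 $ 1 = - (q$1 * q$2 * (2 + I))"
    "metric_matrix sl2_metric q $ 1 $ 3 = - (q$2)"
    "metric_matrix sl2_metric q $ 3 $ 1 = - (q$2)"
    "metric_matrix sl2_metric q $ 2 $ 3 = q$1"
    "metric_matrix sl2_metric q $ 3 $ 2 = q$1"
    "metric_matrix sl2_metric q $ 3 $ 3 = 1"
    using pos unfolding I_def metric_matrix_def
    by (simp_all add: sl2_metric_def sl2_form_def axis_def divide_simps)
       (simp_all add: power2_eq_square algebra_simps)
qed

text \<open>
  Only \<open>I\<close> is not polynomial; its partial derivatives are \<open>- 2 * p$1 * I\<^sup>2\<close> and \<open>- 2 * p$2 * I\<^sup>2\<close>.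
\<close>

lemma partial_deriv_entry:
  fixes p :: "real ^ 3"
  defines "I \<equiv> inverse (1 + (p$1)\<^sup>2 + (p$2)\<^sup>2)"
  shows "partial_deriv i (\<lambda>q. metric_matrix sl2_metric q $ j $ l) p =
    (if i = 3 then 0
     else if j = 1 \<and> l = 1 then (if i = 1 then - 2 * p$1 * I\<^sup>2 * (1 + (p$2)\<^sup>2)
                                else - 2 * p$2 * I\<^sup>2 * (1 + (p$2)\<^sup>2) + 2 * p$2 * (2 + I))
     else if j = 2 \<and> l = 2 then (if i = 2 then - 2 * p$2 * I\<^sup>2 * (1 + (p$1)\<^sup>2)
                                else - 2 * p$1 * I\<^sup>2 * (1 + (p$1)\<^sup>2) + 2 * p$1 * (2 + I))
     else if j = 3 \<and> l = 3 then 0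
     else if j = 3 \<or> l = 3 then (if j = 1 \<or> l = 1 then (if i = 2 then -1 else 0)
                                else (if i = 1 then 1 else 0))
     else if i = 1 then 2 * (p$1)\<^sup>2 * p$2 * I\<^sup>2 - p$2 * (2 + I)
     else 2 * p$1 * (p$2)\<^sup>2 * I\<^sup>2 - p$1 * (2 + I))"
proof -
  have pos: "1 + (p$1)\<^sup>2 + (p$2)\<^sup>2 \<noteq> 0" by (smt (verit) zero_le_power2)
  then have pos': "1 + (p$1 * p$1 + p$2 * p$2) \<noteq> 0" by (simp add: power2_eq_square)
  consider "i = 1" | "i = 2" | "i = 3" using exhaust_3[of i] by blast
  note ci = this
  consider "j = 1" | "j = 2" | "j = 3" using exhaust_3[of j] by blast
  note cj = this
  consider "l = 1" | "l = 2" | "l = 3" using exhaust_3[of l] by blast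
  note cl = this
  show ?thesis
    unfolding partial_deriv_def
    by (rule ci; rule cj; rule cl; hypsubst;
        simp add: metric_matrix_entries axis_def del: One_nat_def;
        (rule DERIV_imp_deriv, (auto intro!: derivative_eq_intros simp: pos pos' I_def power2_eq_square algebra_simps)[1])?)
qed

text \<open>
  The volume form of the base in the coordinates \<open>(u, v)\<close> is \<open>du dv\<close>, and the fibre direction is an
  orthogonal unit direction, so the determinant is 1.
\<close>

lemma det_metric_matrix: "det (metric_matrix sl2_metric p) = 1"
proof -
  define I where "I = inverse (1 + (p$1)\<^sup>2 + (p$2)\<^sup>2)"
  have "I * (1 + (p$1)\<^sup>2 + (p$2)\<^sup>2) = 1"
    unfolding I_def by (rule left_inverse) (smt (verit) zero_le_power2)
  then show ?thesis
    unfolding det_3 metric_matrix_entries I_def[symmetric] by algebra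
qed

text \<open>
  Lowering the index of the acceleration avoids the inverse matrix: what remains is a polynomial
  identity modulo \<open>I * (1 + u\<^sup>2 + v\<^sup>2) = 1\<close>.
\<close>

lemma metric_matrix_mult_accel:
  fixes p X :: "real ^ 3"
  defines "G \<equiv> metric_matrix sl2_metric"
  shows "(\<Sum>i\<in>UNIV. \<Sum>j\<in>UNIV. (partial_deriv i (\<lambda>q. G q $ j $ l) p
       + partial_deriv j (\<lambda>q. G q $ i $ l) p - partial_deriv l (\<lambda>q. G q $ i $ j) p) * X $ i * X $ j)
     = - 2 * (G p *v sl2_accel p X) $ l" (is "?P l")
proof -
  define u v x y z where "u = p$1" and "v = p$2" and "x = X$1" and "y = X$2" and "z = X$3"
  note [simp] = this[symmetric]
  define I where "I = inverse (1 + u\<^sup>2 + v\<^sup>2)"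
  have I: "I * (1 + u\<^sup>2 + v\<^sup>2) = 1"
    unfolding I_def by (rule left_inverse) (smt (verit) zero_le_power2)
  have div: "w / (1 + u\<^sup>2 + v\<^sup>2) = w * I" for w
    by (simp add: I_def divide_inverse)
  have inv: "inverse (1 + u\<^sup>2 + v\<^sup>2) = I"
    by (simp add: I_def)
  have "?P 1" "?P 2" "?P 3"
    unfolding G_def matrix_vector_mult_def sum_3 partial_deriv_entry sl2_accel_def Let_def sl2_form_def
    apply (simp_all add: metric_matrix_entries inv div)
    using I by algebra+
  then show ?thesis
    using exhaust_3[of l] by blast
qed

lemma christoffel_contraction:
  "(\<Sum>i\<in>UNIV. \<Sum>j\<in>UNIV. christoffel sl2_metric p k i j * X $ i * X $ j) = - sl2_accel p X $ k"
proof -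
  define G where "G = metric_matrix sl2_metric"
  define T where "T l i j = partial_deriv i (\<lambda>q. G q $ j $ l) p
       + partial_deriv j (\<lambda>q. G q $ i $ l) p - partial_deriv l (\<lambda>q. G q $ i $ j) p" for l i j
  have inv: "matrix_inv (G p) ** G p = mat 1"
    using someI_ex[of "\<lambda>B. G p ** B = mat 1 \<and> B ** G p = mat 1"] invertible_det_nz[of "G p"]
    unfolding matrix_inv_def invertible_def by (simp add: G_def det_metric_matrix)
  have "(\<Sum>i\<in>UNIV. \<Sum>j\<in>UNIV. christoffel sl2_metric p k i j * X $ i * X $ j)
      = (\<Sum>l\<in>UNIV. matrix_inv (G p) $ k $ l * ((1/2) * (\<Sum>i\<in>UNIV. \<Sum>j\<in>UNIV. T l i j * X $ i * X $ j)))"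
    unfolding christoffel_def G_def[symmetric] T_def[symmetric] sum_3 by (simp add: algebra_simps)
  also have "\<dots> = (\<Sum>l\<in>UNIV. matrix_inv (G p) $ k $ l * - (G p *v sl2_accel p X) $ l)"
    unfolding T_def G_def metric_matrix_mult_accel by simp
  also have "\<dots> = - (matrix_inv (G p) *v (G p *v sl2_accel p X)) $ k"
    by (simp add: matrix_vector_mult_def[of "matrix_inv (G p)"] sum_negf)
  also have "\<dots> = - sl2_accel p X $ k"
    by (simp add: matrix_vector_mul_assoc inv)
  finally show ?thesis .
qed

definition sl2_geodesic :: "real set \<Rightarrow> (real \<Rightarrow> real ^ 3) \<Rightarrow> (real \<Rightarrow> real ^ 3) \<Rightarrow> bool" where
  "sl2_geodesic I c V \<longleftrightarrow> (\<forall>t\<in>I. (c has_vector_derivative V t) (at t within I) \<and>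
     (V has_vector_derivative sl2_accel (c t) (V t)) (at t within I))"

lemma geodesic_on_iff: "geodesic_on sl2_metric I c \<longleftrightarrow> (\<exists>V. sl2_geodesic I c V)"
proof -
  have *: "(\<forall>k. A $ k + - sl2_accel p X $ k = 0) \<longleftrightarrow> A = sl2_accel p X" for A p X
    by (auto simp: vec_eq_iff)
  show ?thesis
    unfolding geodesic_on_def christoffel_contraction * sl2_geodesic_def
    by (rule iffI; elim exE; intro exI) (force, fast)
qed

lemma sl2_accel_scale: "sl2_accel p (r *\<^sub>R X) = r\<^sup>2 *\<^sub>R sl2_accel p X"
  by (simp add: sl2_accel_def sl2_form_def Let_def vec_eq_iff forall_3 power2_eq_square
      add_divide_distrib algebra_simps)

lemma sl2_metric_scale: "sl2_metric p (r *\<^sub>R X) (s *\<^sub>R Y) = r * s * sl2_metric p X Y"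
  by (simp add: sl2_metric_def sl2_form_def add_divide_distrib algebra_simps)

section \<open>Arcs of geodesics and the angles between them\<close>

lemma has_vector_derivative_vec_iff:
  fixes f :: "real \<Rightarrow> real ^ 'n"
  shows "(f has_vector_derivative D) (at t within S) \<longleftrightarrow>
    (\<forall>i. ((\<lambda>t. f t $ i) has_real_derivative D $ i) (at t within S))"
proof -
  have "(f has_vector_derivative D) (at t within S) \<longleftrightarrow>
     ((\<lambda>t. \<chi> i. f t $ i) has_derivative (\<lambda>h. \<chi> i. h * D $ i)) (at t within S)"
    by (simp add: has_vector_derivative_def scaleR_vec_def)
  also have "\<dots> \<longleftrightarrow> (\<forall>i. ((\<lambda>t. f t $ i) has_derivative (\<lambda>h. h * D $ i)) (at t within S))"
    by (subst has_derivative_componentwise_within) (auto simp: Basis_vec_def inner_axis)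
  finally show ?thesis
    by (simp add: has_field_derivative_def mult.commute[of _ "D $ _"])
qed

lemma has_vector_derivative_vec3_iff:
  fixes f :: "real \<Rightarrow> real ^ 3"
  shows "(f has_vector_derivative D) (at t within S) \<longleftrightarrow>
    ((\<lambda>t. f t $ 1) has_real_derivative D $ 1) (at t within S) \<and>
    ((\<lambda>t. f t $ 2) has_real_derivative D $ 2) (at t within S) \<and>
    ((\<lambda>t. f t $ 3) has_real_derivative D $ 3) (at t within S)"
  unfolding has_vector_derivative_vec_iff by (simp add: forall_3)

text \<open>
  The parameters \<open>s\<close> and \<open>t\<close> may come in either order, so that reversing an arc means exchanging them.
\<close>

definition subarc :: "(real \<Rightarrow> real ^ 3) \<Rightarrow> real \<Rightarrow> real \<Rightarrow> real \<Rightarrow> real ^ 3" where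
  "subarc c s t = (\<lambda>x. c (s + x * (t - s)))"

lemma reversepath_subarc: "reversepath (subarc c s t) = subarc c t s"
  by (auto simp: reversepath_def subarc_def algebra_simps)

lemma pathstart_subarc [simp]: "pathstart (subarc c s t) = c s"
  by (simp add: pathstart_def subarc_def)

lemma pathfinish_subarc [simp]: "pathfinish (subarc c s t) = c t"
  by (simp add: pathfinish_def subarc_def)

lemma geodesic_subarc:
  assumes "sl2_geodesic UNIV c V"
  shows "sl2_geodesic UNIV (subarc c s t) (\<lambda>x. (t - s) *\<^sub>R V (s + x * (t - s)))"
  unfolding sl2_geodesic_def
proof (intro ballI conjI)
  fix x :: real
  have lin: "((\<lambda>x. s + x * (t - s)) has_vector_derivative (t - s)) (at x)"
    by (auto intro!: derivative_eq_intros simp: has_real_derivative_iff_has_vector_derivative[symmetric])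
  have c: "(c has_vector_derivative V y) (at y)"
    and V: "(V has_vector_derivative sl2_accel (c y) (V y)) (at y)" for y
    using assms by (auto simp: sl2_geodesic_def)
  show "(subarc c s t has_vector_derivative (t - s) *\<^sub>R V (s + x * (t - s))) (at x)"
    using vector_diff_chain_at[OF lin c] by (simp add: subarc_def o_def)
  have "((\<lambda>x. V (s + x * (t - s))) has_vector_derivative
      (t - s) *\<^sub>R sl2_accel (subarc c s t x) (V (s + x * (t - s)))) (at x)"
    using vector_diff_chain_at[OF lin V] by (simp add: subarc_def o_def)
  from has_vector_derivative_scaleR[OF DERIV_const this, of "t - s"]
  show "((\<lambda>x. (t - s) *\<^sub>R V (s + x * (t - s))) has_vector_derivative
      sl2_accel (subarc c s t x) ((t - s) *\<^sub>R V (s + x * (t - s)))) (at x)"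
    by (simp add: sl2_accel_scale power2_eq_square)
qed

lemma geodesic_segment_subarc:
  assumes "sl2_geodesic UNIV c V" "c s = A" "c t = B"
  shows "geodesic_segment sl2_metric A B (subarc c s t)"
proof -
  have "sl2_geodesic {0..1} (subarc c s t) (\<lambda>x. (t - s) *\<^sub>R V (s + x * (t - s)))"
    using geodesic_subarc[OF assms(1), of s t] unfolding sl2_geodesic_def
    by (blast intro: has_vector_derivative_at_within)
  then show ?thesis
    unfolding geodesic_segment_def geodesic_on_iff using assms(2,3) by auto
qed

lemma initial_velocity_subarc:
  assumes "sl2_geodesic UNIV c V"
  shows "initial_velocity (subarc c s t) = (t - s) *\<^sub>R V s"
proof -
  have "(subarc c s t has_vector_derivative (t - s) *\<^sub>R V (s + 0 * (t - s))) (at 0)"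
    using geodesic_subarc[OF assms, of s t] unfolding sl2_geodesic_def by blast
  then have "(subarc c s t has_vector_derivative (t - s) *\<^sub>R V s) (at 0 within {0..1})"
    by (simp add: has_vector_derivative_at_within)
  then show ?thesis
    unfolding initial_velocity_def by (intro vector_derivative_within_closed_interval) auto
qed

text \<open>
  Rescaling a geodesic to the unit interval multiplies its velocity by \<open>t - s\<close>, of which only the
  sign affects the angle. In the degenerate case \<open>s = t\<close> both sides are \<open>arccos 0\<close>.
\<close>

lemma angle_between_subarc:
  assumes "sl2_geodesic UNIV c V" "sl2_geodesic UNIV d W"
  shows "angle_between sl2_metric (subarc c s t) (subarc d s' t') =
    arccos (sgn (t - s) * sgn (t' - s') *
      (sl2_metric (c s) (V s) (W s') / (sqrt (sl2_metric (c s) (V s) (V s)) * sqrt (sl2_metric (c s) (W s') (W s')))))"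
proof -
  have "a * b * g / (\<bar>a\<bar> * p * (\<bar>b\<bar> * q)) = sgn a * sgn b * (g / (p * q))" for a b g p q :: real
    by (simp add: abs_if sgn_if)
  then show ?thesis
    by (simp add: angle_between_def riemannian_angle_def initial_velocity_subarc[OF assms(1)]
      initial_velocity_subarc[OF assms(2)] sl2_metric_scale real_sqrt_mult)
qed

section \<open>Geodesics through the origin\<close>

text \<open>
  Translation along the fibres and rotation about the axis \<open>u = v = 0\<close> are isometries, so a geodesic
  has the conserved quantities \<open>C = z + \<alpha>\<close> and \<open>J = K * \<alpha> + C * (K - 1)\<close>. If it meets the axis, then
  \<open>J = 0\<close>, whence the height changes at the rate \<open>z = C * (2 * K - 1) / K\<close>, which has constant sign.
  A geodesic through the origin that returns to height 0 must therefore have \<open>C = 0\<close>, and then it stays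
  at height 0 and its projection to the \<open>(u, v)\<close>-plane is a line: its velocity there is \<open>sqrt K\<close> times a
  constant vector \<open>(Q, R)\<close>.
\<close>

lemma geodesic_through_origin:
  assumes c: "geodesic_on sl2_metric {a..b} c" and "a < b"
    and O: "0 \<in> c ` {a..b}" and P: "P \<in> c ` {a..b}" "P \<noteq> 0" "P $ 3 = 0"
    and X: "X \<in> c ` {a..b}"
  shows "X $ 3 = 0" and "P $ 1 * X $ 2 = P $ 2 * X $ 1"
proof -
  obtain V where V: "sl2_geodesic {a..b} c V"
    using c geodesic_on_iff by blast
  define u v x y z where "u t = c t $ 1" and "v t = c t $ 2"
    and "x t = V t $ 1" and "y t = V t $ 2" and "z t = V t $ 3" for t
  note [simp] = this[symmetric]
  define K where "K t = 1 + (u t)\<^sup>2 + (v t)\<^sup>2" for t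
  define \<alpha> where "\<alpha> t = u t * y t - v t * x t" for t
  define B where "B t = z t + 2 * \<alpha> t" for t
  define k where "k t = (u t * x t + v t * y t) / K t" for t
  have Kpos: "K t > 0" for t
    unfolding K_def by (smt (verit) zero_le_power2)
  have d: "(u has_real_derivative x t) (at t within {a..b})"
    "(v has_real_derivative y t) (at t within {a..b})"
    "((\<lambda>t. c t $ 3) has_real_derivative z t) (at t within {a..b})"
    "(x has_real_derivative (\<alpha> t + 2 * K t * B t) * y t + k t * (x t - v t * (\<alpha> t + 2 * (K t + 1) * B t)))
       (at t within {a..b})"
    "(y has_real_derivative - (\<alpha> t + 2 * K t * B t) * x t + k t * (y t + u t * (\<alpha> t + 2 * (K t + 1) * B t)))
       (at t within {a..b})"
    "(z has_real_derivative 2 * k t * B t) (at t within {a..b})"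
    if "t \<in> {a..b}" for t
    using V that unfolding sl2_geodesic_def has_vector_derivative_vec3_iff
    by (simp_all add: sl2_accel_def Let_def sl2_form_def K_def \<alpha>_def B_def k_def)
  have kK: "k t * K t = u t * x t + v t * y t" for t
    using Kpos[of t] by (simp add: k_def)
  have const: "\<exists>C. \<forall>t\<in>{a..b}. f t = C"
    if "\<And>t. t \<in> {a..b} \<Longrightarrow> (f has_real_derivative 0) (at t within {a..b})" for f
    using has_field_derivative_zero_constant[of "{a..b}" f] that by auto
  have d\<alpha>: "(\<alpha> has_real_derivative - 2 * k t * B t) (at t within {a..b})"
    and dK: "(K has_real_derivative 2 * k t * K t) (at t within {a..b})" if t: "t \<in> {a..b}" for t
  proof -
    have eq: "x t * y t + u t * (- (\<alpha> t + 2 * K t * B t) * x t + k t * (y t + u t * (\<alpha> t + 2 * (K t + 1) * B t)))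
       - (x t * y t + v t * ((\<alpha> t + 2 * K t * B t) * y t + k t * (x t - v t * (\<alpha> t + 2 * (K t + 1) * B t))))
       = - 2 * k t * B t"
      using kK[of t] K_def[of t] \<alpha>_def[of t] by algebra
    have "((\<lambda>t. u t * y t - v t * x t) has_real_derivative - 2 * k t * B t) (at t within {a..b})"

      by (rule derivative_eq_intros d[OF t] refl)+ (use eq in algebra)
    then show "(\<alpha> has_real_derivative - 2 * k t * B t) (at t within {a..b})"
      by (simp add: \<alpha>_def[abs_def])
    have "((\<lambda>t. 1 + (u t)\<^sup>2 + (v t)\<^sup>2) has_real_derivative 2 * k t * K t) (at t within {a..b})"
      by (rule derivative_eq_intros d[OF t] refl)+ (use kK[of t] in \<open>simp add: algebra_simps\<close>)
    then show "(K has_real_derivative 2 * k t * K t) (at t within {a..b})"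
      by (simp add: K_def[abs_def])
  qed
  have "((\<lambda>t. z t + \<alpha> t) has_real_derivative 0) (at t within {a..b})" if t: "t \<in> {a..b}" for t
    by (rule derivative_eq_intros d[OF t] d\<alpha>[OF t] refl)+ simp
  then have "\<exists>c. \<forall>t\<in>{a..b}. z t + \<alpha> t = c"
    by (rule const)
  then obtain C where C: "\<And>t. t \<in> {a..b} \<Longrightarrow> z t + \<alpha> t = C"
    by blast
  have "((\<lambda>t. K t * \<alpha> t + C * (K t - 1)) has_real_derivative 0) (at t within {a..b})" if t: "t \<in> {a..b}" for t
  proof -
    have "B t = C + \<alpha> t"
      using C[OF t] B_def[of t] by simp
    then show ?thesis
      by - ((rule derivative_eq_intros d[OF t] d\<alpha>[OF t] dK[OF t] refl)+, simp add: algebra_simps)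
  qed
  then have "\<exists>c. \<forall>t\<in>{a..b}. K t * \<alpha> t + C * (K t - 1) = c"
    by (rule const)
  then obtain J where J: "\<And>t. t \<in> {a..b} \<Longrightarrow> K t * \<alpha> t + C * (K t - 1) = J"
    by blast
  obtain t0 where t0: "t0 \<in> {a..b}" "c t0 = 0"
    using O by auto
  obtain t1 where t1: "t1 \<in> {a..b}" "c t1 = P"
    using P(1) by auto
  obtain t2 where t2: "t2 \<in> {a..b}" "c t2 = X"
    using X by auto
  have uv0: "u t0 = 0" "v t0 = 0"
    using t0(2) by (simp_all add: u_def v_def)
  have "J = 0"
    using J[OF t0(1)] uv0 by (simp add: K_def \<alpha>_def)
  \<comment> \<open>Rolle, for the two distinct times at which the geodesic is at the origin and at \<open>P\<close>\<close>
  have "\<exists>t\<in>{a..b}. z t = 0"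
  proof -
    have rolle: "\<exists>t\<in>{a..b}. z t = 0" if st: "s < t" "s \<in> {a..b}" "t \<in> {a..b}" "c s $ 3 = c t $ 3" for s t
    proof -
      have "\<exists>\<xi>\<in>{s<..<t}. c t $ 3 - c s $ 3 = z \<xi> * (t - s)"
      proof (rule mvt_simple[OF st(1)])
        fix r assume "s \<le> r" "r \<le> t"
        then have "((\<lambda>t. c t $ 3) has_real_derivative z r) (at r within {a..b})"
          using st by (intro d) auto
        then have "((\<lambda>t. c t $ 3) has_real_derivative z r) (at r within {s..t})"
          by (rule DERIV_subset) (use st in auto)
        then show "((\<lambda>t. c t $ 3) has_derivative (\<lambda>h. z r * h)) (at r within {s..t})"
          by (simp add: has_field_derivative_def)
      qed
      then show ?thesis
        using st by force
    qed
    have "t0 \<noteq> t1" "c t0 $ 3 = c t1 $ 3"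
      using t0 t1 P by auto
    then show ?thesis
      using rolle[of t0 t1] rolle[of t1 t0] t0(1) t1(1) by (cases "t0 < t1") auto
  qed
  then obtain t where t: "t \<in> {a..b}" "z t = 0"
    by blast
  have "C * (2 * K t - 1) = 0"
  proof -
    have "\<alpha> t = C"
      using C[OF t(1)] t(2) by simp
    then show ?thesis
      using J[OF t(1)] \<open>J = 0\<close> by (simp add: algebra_simps)
  qed
  moreover have "2 * K t - 1 > 0"
  proof -
    have "K t \<ge> 1"
      by (simp add: K_def)
    then show ?thesis
      by simp
  qed
  ultimately have "C = 0"
    by simp
  have \<alpha>0: "\<alpha> t = 0" and z0: "z t = 0" and B0: "B t = 0" if t: "t \<in> {a..b}" for t
    using J[OF t] C[OF t] Kpos[of t] \<open>C = 0\<close> \<open>J = 0\<close> by (auto simp: B_def)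
  have "\<exists>C. \<forall>t\<in>{a..b}. c t $ 3 = C"
  proof (rule const)
    fix t assume "t \<in> {a..b}"
    then show "((\<lambda>t. c t $ 3) has_real_derivative 0) (at t within {a..b})"
      using d(3)[of t] z0[of t] by simp
  qed
  then show "X $ 3 = 0"
    using t0 t2 by (metis zero_index)
  define N where "N t = sqrt (K t)" for t
  have Npos: "N t > 0" for t
    using Kpos[of t] by (simp add: N_def)
  have dN: "(N has_real_derivative k t * N t) (at t within {a..b})" if t: "t \<in> {a..b}" for t
  proof -
    have "inverse (sqrt (K t)) / 2 * (2 * k t * K t) = k t * sqrt (K t)"
      using Kpos[of t] by (simp add: field_simps)
    then have "((\<lambda>t. sqrt (K t)) has_real_derivative k t * sqrt (K t)) (at t within {a..b})"
      using DERIV_chain2[OF DERIV_real_sqrt[OF Kpos[of t]] dK[OF t]] by metis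
    then show ?thesis
      by (simp add: N_def[abs_def])
  qed
  have quot: "((\<lambda>t. x t / N t) has_real_derivative 0) (at t within {a..b})"
    "((\<lambda>t. y t / N t) has_real_derivative 0) (at t within {a..b})" if t: "t \<in> {a..b}" for t
    using DERIV_divide[OF d(4)[OF t] dN[OF t]] DERIV_divide[OF d(5)[OF t] dN[OF t]] Npos[of t]
    by (simp_all add: B0[OF t] \<alpha>0[OF t] algebra_simps)
  have "\<exists>q. \<forall>t\<in>{a..b}. x t / N t = q"
    by (rule const[OF quot(1)])
  moreover have "\<exists>q. \<forall>t\<in>{a..b}. y t / N t = q"
    by (rule const[OF quot(2)])
  ultimately obtain Q R where QR0: "\<And>t. t \<in> {a..b} \<Longrightarrow> x t / N t = Q" "\<And>t. t \<in> {a..b} \<Longrightarrow> y t / N t = R"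
    by blast
  then have QR: "x t = Q * N t" "y t = R * N t" if "t \<in> {a..b}" for t
    using QR0[OF that] Npos[of t] by (simp_all add: nonzero_divide_eq_eq)
  have "((\<lambda>t. R * u t - Q * v t) has_real_derivative 0) (at t within {a..b})" if t: "t \<in> {a..b}" for t
    by (rule derivative_eq_intros d[OF t] refl)+ (simp add: QR[OF t])
  then have "\<exists>c. \<forall>t\<in>{a..b}. R * u t - Q * v t = c"
    by (rule const)
  then obtain D where D: "\<And>t. t \<in> {a..b} \<Longrightarrow> R * u t - Q * v t = D"
    by blast
  then have lin: "R * u t = Q * v t" if "t \<in> {a..b}" for t
    using D[OF that] D[OF t0(1)] uv0 by simp
  have "Q \<noteq> 0 \<or> R \<noteq> 0"
  proof (rule ccontr)
    assume "\<not> (Q \<noteq> 0 \<or> R \<noteq> 0)"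
    then have "\<exists>C. \<forall>t\<in>{a..b}. u t = C" "\<exists>C. \<forall>t\<in>{a..b}. v t = C"
      using d(1,2) QR by - (rule const; force)+
    then have "u t1 = 0" "v t1 = 0"
      using uv0 t0(1) t1(1) by auto
    then have "P $ 1 = 0" "P $ 2 = 0"
      using t1(2) u_def[of t1] v_def[of t1] by metis+
    then show False
      using P(2,3) by (simp add: vec_eq_iff forall_3)
  qed
  then show "P $ 1 * X $ 2 = P $ 2 * X $ 1"
    using lin[OF t1(1)] lin[OF t2(1)] unfolding u_def v_def t1(2) t2(2)
    by algebra
qed

lemma not_on_common_geodesic_origin:
  assumes "A \<noteq> 0" "A $ 3 = 0" and "B $ 3 \<noteq> 0 \<or> A $ 1 * B $ 2 \<noteq> A $ 2 * B $ 1"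
  shows "\<not> on_common_geodesic sl2_metric {0, A, B}"
proof
  assume "on_common_geodesic sl2_metric {0, A, B}"
  then obtain s t c where "s < t" and c: "geodesic_on sl2_metric {s..t} c"
    and "{0, A, B} \<subseteq> c ` {s..t}"
    unfolding on_common_geodesic_def by blast
  then have "0 \<in> c ` {s..t}" "A \<in> c ` {s..t}" "B \<in> c ` {s..t}"
    by simp_all
  with geodesic_through_origin[OF c \<open>s < t\<close>, of A B] assms show False
    by metis
qed

section \<open>Geodesics as orbits of isometries\<close>

text \<open>
  Every geodesic of this space is an orbit of a one-parameter group of isometries. With
  \<open>z\<^sub>0 = a + \<i> b\<close> and \<open>z\<^sub>1 = p + \<i> q\<close>, the assumptions say that \<open>(z\<^sub>0, z\<^sub>1)\<close> moves on the hyperboloid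
  under the linear flow \<open>z\<^sub>0' = \<i> \<mu> z\<^sub>0 + (m + \<i> n) cnj z\<^sub>1\<close>, \<open>z\<^sub>1' = \<i> \<mu> z\<^sub>1 + (m + \<i> n) cnj z\<^sub>0\<close>, an
  infinitesimal left translation. The curve \<open>c\<close> combines it with a motion along the
  fibres: \<open>u + \<i> v = z\<^sub>1 z\<^sub>0 / \<bar>z\<^sub>0\<bar>\<close> and \<open>\<phi> = 2 C t + arg z\<^sub>0\<close>. Since \<open>e\<close> is the (conserved) angular
  momentum of \<open>z\<^sub>0\<close>, the rate of \<open>arg z\<^sub>0\<close> is \<open>e / \<bar>z\<^sub>0\<bar>\<^sup>2\<close>. The orbit of a point under a Killing field is
  a geodesic when the length of the field is critical there; this is the condition \<open>\<mu> = C + 2 e\<close>, and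
  \<open>C\<close> is then the fibre component of the velocity.
\<close>

lemma orbit_geodesic:
  fixes a b p q \<phi> :: "real \<Rightarrow> real" and m n \<mu> e C :: real
  assumes a: "\<And>t. (a has_real_derivative - \<mu> * b t + m * p t + n * q t) (at t)"
    and b: "\<And>t. (b has_real_derivative \<mu> * a t + n * p t - m * q t) (at t)"
    and p: "\<And>t. (p has_real_derivative - \<mu> * q t + m * a t + n * b t) (at t)"
    and q: "\<And>t. (q has_real_derivative \<mu> * p t + n * a t - m * b t) (at t)"
    and norm: "\<And>t. (a t)\<^sup>2 + (b t)\<^sup>2 = 1 + (p t)\<^sup>2 + (q t)\<^sup>2"
    and e: "\<And>t. a t * (\<mu> * a t + n * p t - m * q t) - b t * (- \<mu> * b t + m * p t + n * q t) = e"
    and \<mu>: "\<mu> = C + 2 * e"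
    and \<phi>: "\<And>t. (\<phi> has_real_derivative 2 * C + e / ((a t)\<^sup>2 + (b t)\<^sup>2)) (at t)"
  defines "N \<equiv> \<lambda>t. sqrt ((a t)\<^sup>2 + (b t)\<^sup>2)"
  defines "u \<equiv> \<lambda>t. (p t * a t - q t * b t) / N t"
    and "v \<equiv> \<lambda>t. (p t * b t + q t * a t) / N t"
    and "g \<equiv> \<lambda>t. \<mu> + e / (N t)\<^sup>2"
  defines "c \<equiv> \<lambda>t. vector [u t, v t, \<phi> t] :: real ^ 3"
    and "V \<equiv> \<lambda>t. vector [m * N t - v t * g t, n * N t + u t * g t, 2 * C + e / (N t)\<^sup>2] :: real ^ 3"
  shows "sl2_geodesic UNIV c V"
    and "sl2_metric (c t) (V t) (V t) = m\<^sup>2 + n\<^sup>2 + 4 * e * (e - \<mu>) + C\<^sup>2"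
    and "u t * V t $ 1 + v t * V t $ 2 = N t * (m * u t + n * v t)"
    and "(N t)\<^sup>2 = 1 + (u t)\<^sup>2 + (v t)\<^sup>2"
proof -
  have N2: "(N t)\<^sup>2 = (a t)\<^sup>2 + (b t)\<^sup>2" for t
    by (simp add: N_def)
  have Npos: "N t > 0" for t
    unfolding N_def norm by (simp add: add_pos_nonneg)
  have uN: "u t * N t = p t * a t - q t * b t" and vN: "v t * N t = p t * b t + q t * a t" for t
    using Npos[of t] by (simp_all add: u_def v_def)
  have radius: "(N t)\<^sup>2 = 1 + (u t)\<^sup>2 + (v t)\<^sup>2" for t
  proof -
    have "(N t)\<^sup>2 * ((u t)\<^sup>2 + (v t)\<^sup>2) = (N t)\<^sup>2 * ((p t)\<^sup>2 + (q t)\<^sup>2)"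
      using uN[of t] vN[of t] N2[of t] by algebra
    then have "(u t)\<^sup>2 + (v t)\<^sup>2 = (p t)\<^sup>2 + (q t)\<^sup>2"
      using Npos[of t] by simp
    then show ?thesis
      using N2[of t] norm[of t] by simp
  qed
  show "(N t)\<^sup>2 = 1 + (u t)\<^sup>2 + (v t)\<^sup>2"
    by (rule radius)
  define E where "E t = e / (N t)\<^sup>2" for t
  have E: "E t * (N t)\<^sup>2 = e" for t
    using Npos[of t] by (simp add: E_def)
  \<comment> \<open>the angular momentum expressed in the coordinates of the curve; with \<open>radius\<close> it is the only input of the identities below\<close>
  have ang: "n * u t - m * v t = N t * (E t - \<mu>)" for t
  proof -
    have "N t * (n * u t - m * v t) = N t * (N t * (E t - \<mu>))"
      using uN[of t] vN[of t] E[of t] e[of t] N2[of t] by algebra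
    then show ?thesis
      using Npos[of t] by simp
  qed
  have g: "g t = \<mu> + E t" for t
    by (simp add: g_def E_def)
  have dN: "(N has_real_derivative m * u t + n * v t) (at t)" for t
  proof -
    define X where "X = 2 * (N t * (m * u t + n * v t))"
    have "((\<lambda>t. (a t)\<^sup>2 + (b t)\<^sup>2) has_real_derivative X) (at t)"
    proof (rule derivative_eq_intros a b refl)+
      have "2 * (a t * (- \<mu> * b t + m * p t + n * q t) + b t * (\<mu> * a t + n * p t - m * q t)) = X"
        using uN[of t] vN[of t] unfolding X_def by algebra
      then show "real 2 * ((- \<mu> * b t + m * p t + n * q t) * a t ^ (2 - Suc 0))
          + real 2 * ((\<mu> * a t + n * p t - m * q t) * b t ^ (2 - Suc 0)) = X"
        by (simp add: algebra_simps)
    qed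
    moreover have "(a t)\<^sup>2 + (b t)\<^sup>2 > 0"
      using Npos[of t] by (simp add: N_def)
    ultimately have "(N has_real_derivative inverse (N t) / 2 * X) (at t)"
      unfolding N_def by (intro DERIV_chain2[OF DERIV_real_sqrt])
    moreover have "inverse (N t) / 2 * X = m * u t + n * v t"
      using Npos[of t] by (simp add: X_def)
    ultimately show ?thesis
      by metis
  qed
  have du: "(u has_real_derivative m * N t - v t * g t) (at t)" for t
  proof -
    have D: "((\<lambda>t. p t * a t - q t * b t) has_real_derivative m * (2 * (N t)\<^sup>2 - 1) - 2 * \<mu> * N t * v t) (at t)"
    proof -
      have "(- \<mu> * q t + m * a t + n * b t) * a t + (- \<mu> * b t + m * p t + n * q t) * p t
        - ((\<mu> * p t + n * a t - m * b t) * b t + (\<mu> * a t + n * p t - m * q t) * q t)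
        = m * (2 * (N t)\<^sup>2 - 1) - 2 * \<mu> * N t * v t"
        using vN[of t] N2[of t] norm[of t] by algebra
      then show ?thesis
        using DERIV_diff[OF DERIV_mult[OF p a] DERIV_mult[OF q b], of t] by metis
    qed
    have "((m * (2 * (N t)\<^sup>2 - 1) - 2 * \<mu> * N t * v t) * N t - (u t * N t) * (m * u t + n * v t))
        = (m * N t - v t * g t) * (N t * N t)"
      using ang[of t] radius[of t] g[of t] by algebra
    then have "((m * (2 * (N t)\<^sup>2 - 1) - 2 * \<mu> * N t * v t) * N t - (u t * N t) * (m * u t + n * v t)) / (N t * N t)
        = m * N t - v t * g t"
      using Npos[of t] by simp
    then show ?thesis
      using DERIV_divide[OF D dN] Npos[of t] unfolding uN u_def[symmetric] by (metis less_irrefl)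
  qed
  have dv: "(v has_real_derivative n * N t + u t * g t) (at t)" for t
  proof -
    have D: "((\<lambda>t. p t * b t + q t * a t) has_real_derivative n * (2 * (N t)\<^sup>2 - 1) + 2 * \<mu> * N t * u t) (at t)"
    proof -
      have "(- \<mu> * q t + m * a t + n * b t) * b t + (\<mu> * a t + n * p t - m * q t) * p t
        + ((\<mu> * p t + n * a t - m * b t) * a t + (- \<mu> * b t + m * p t + n * q t) * q t)
        = n * (2 * (N t)\<^sup>2 - 1) + 2 * \<mu> * N t * u t"
        using uN[of t] N2[of t] norm[of t] by algebra
      then show ?thesis
        using DERIV_add[OF DERIV_mult[OF p b] DERIV_mult[OF q a], of t] by metis
    qed
    have "((n * (2 * (N t)\<^sup>2 - 1) + 2 * \<mu> * N t * u t) * N t - (v t * N t) * (m * u t + n * v t))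
        = (n * N t + u t * g t) * (N t * N t)"
      using ang[of t] radius[of t] g[of t] by algebra
    then have "((n * (2 * (N t)\<^sup>2 - 1) + 2 * \<mu> * N t * u t) * N t - (v t * N t) * (m * u t + n * v t)) / (N t * N t)
        = n * N t + u t * g t"
      using Npos[of t] by simp
    then show ?thesis
      using DERIV_divide[OF D dN] Npos[of t] unfolding vN v_def[symmetric] by (metis less_irrefl)
  qed
  define r where "r t = (m * u t + n * v t) / N t" for t
  have r: "r t * N t = m * u t + n * v t" for t
    using Npos[of t] by (simp add: r_def)
  have dE: "(E has_real_derivative - 2 * E t * r t) (at t)" for t
  proof -
    have "(0 * (N t)\<^sup>2 - e * (2 * N t * (m * u t + n * v t))) / ((N t)\<^sup>2 * (N t)\<^sup>2) = - 2 * E t * r t"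
      using Npos[of t] by (simp add: E_def r_def field_simps power2_eq_square)
    then show ?thesis
      unfolding E_def[abs_def] using Npos[of t]
      by (auto intro!: derivative_eq_intros dN simp: E_def r_def field_simps power2_eq_square)
  qed
  have form: "sl2_form (c t) (V t) = - C - E t" for t
    using ang[of t] radius[of t] E[of t] \<mu> g[of t]
    unfolding sl2_form_def c_def V_def by simp algebra
  show radial: "u t * V t $ 1 + v t * V t $ 2 = N t * (m * u t + n * v t)" for t
    unfolding V_def by (simp add: algebra_simps)
  show "sl2_geodesic UNIV c V"
    unfolding sl2_geodesic_def
  proof (intro ballI conjI)
    fix t
    show "(c has_vector_derivative V t) (at t)"
      unfolding has_vector_derivative_vec3_iff
      using du[of t] dv[of t] \<phi>[of t] by (simp add: c_def V_def N2)
    have k: "(c t $ 1 * V t $ 1 + c t $ 2 * V t $ 2) / (N t)\<^sup>2 = r t"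
      using radial[of t] Npos[of t] by (simp add: c_def r_def power2_eq_square)
    have B: "V t $ 3 + 2 * sl2_form (c t) (V t) = - E t"
      unfolding form by (simp add: V_def E_def)
    have K: "1 + (c t $ 1)\<^sup>2 + (c t $ 2)\<^sup>2 = (N t)\<^sup>2"
      unfolding radius by (simp add: c_def)
    show "(V has_vector_derivative sl2_accel (c t) (V t)) (at t)"
      unfolding has_vector_derivative_vec3_iff sl2_accel_def Let_def K k B unfolding form vector_3
    proof (intro conjI)
      have dg: "(g has_real_derivative - 2 * E t * r t) (at t)"
        using DERIV_add[OF DERIV_const dE[of t], of \<mu>] by (simp add: g[abs_def])
      have "((\<lambda>t. V t $ 1) has_real_derivative
          (m * u t + n * v t) * m - ((n * N t + u t * g t) * g t + - 2 * E t * r t * v t)) (at t)"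
        using DERIV_diff[OF DERIV_mult[OF DERIV_const dN] DERIV_mult[OF dv dg], of m]
        by (simp add: V_def)
      moreover have "(m * u t + n * v t) * m - ((n * N t + u t * g t) * g t + - 2 * E t * r t * v t)
          = (- C - E t + 2 * (N t)\<^sup>2 * - E t) * V t $ 2
            + r t * (V t $ 1 - c t $ 2 * (- C - E t + 2 * ((N t)\<^sup>2 + 1) * - E t))"
        unfolding V_def c_def vector_3 using r[of t] g[of t] \<mu> E[of t] by algebra
      ultimately show "((\<lambda>t. V t $ 1) has_real_derivative
          (- C - E t + 2 * (N t)\<^sup>2 * - E t) * V t $ 2
            + r t * (V t $ 1 - c t $ 2 * (- C - E t + 2 * ((N t)\<^sup>2 + 1) * - E t))) (at t)"
        by metis
      have "((\<lambda>t. V t $ 2) has_real_derivative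
          (m * u t + n * v t) * n + ((m * N t - v t * g t) * g t + - 2 * E t * r t * u t)) (at t)"
        using DERIV_add[OF DERIV_mult[OF DERIV_const dN] DERIV_mult[OF du dg], of n]
        by (simp add: V_def)
      moreover have "(m * u t + n * v t) * n + ((m * N t - v t * g t) * g t + - 2 * E t * r t * u t)
          = - (- C - E t + 2 * (N t)\<^sup>2 * - E t) * V t $ 1
            + r t * (V t $ 2 + c t $ 1 * (- C - E t + 2 * ((N t)\<^sup>2 + 1) * - E t))"
        unfolding V_def c_def vector_3 using r[of t] g[of t] \<mu> E[of t] by algebra
      ultimately show "((\<lambda>t. V t $ 2) has_real_derivative
          - (- C - E t + 2 * (N t)\<^sup>2 * - E t) * V t $ 1
            + r t * (V t $ 2 + c t $ 1 * (- C - E t + 2 * ((N t)\<^sup>2 + 1) * - E t))) (at t)"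
        by metis
      show "((\<lambda>t. V t $ 3) has_real_derivative 2 * r t * - E t) (at t)"
        using DERIV_add[OF DERIV_const dE[of t], of "2 * C"] by (simp add: V_def E_def[abs_def] mult_ac)
    qed
  qed
  have "(V t $ 1)\<^sup>2 + (V t $ 2)\<^sup>2 + ((N t)\<^sup>2 + 1) * (- C - E t) * (- C - E t)
      = (N t)\<^sup>2 * (m\<^sup>2 + n\<^sup>2 + 4 * e * (e - \<mu>))"
    unfolding V_def vector_3 using ang[of t] radius[of t] g[of t] \<mu> E[of t] by algebra
  moreover have "sl2_metric (c t) (V t) (V t)
      = ((V t $ 1)\<^sup>2 + (V t $ 2)\<^sup>2 + ((N t)\<^sup>2 + 1) * (- C - E t) * (- C - E t)) / (N t)\<^sup>2 + C\<^sup>2"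
    unfolding sl2_metric_def form radius
    by (simp add: c_def V_def E_def power2_eq_square algebra_simps)
  ultimately show "sl2_metric (c t) (V t) (V t) = m\<^sup>2 + n\<^sup>2 + 4 * e * (e - \<mu>) + C\<^sup>2"
    using Npos[of t] by simp
qed

section \<open>Explicit families of geodesics\<close>

lemma fibre_geodesic:
  "sl2_geodesic UNIV (\<lambda>t. vector [0, 0, t]) (\<lambda>t. vector [0, 0, 1])"
  unfolding sl2_geodesic_def has_vector_derivative_vec3_iff
  by (auto simp: sl2_accel_def Let_def sl2_form_def)

lemma radial_geodesic:
  assumes "x\<^sup>2 + y\<^sup>2 = 1"
  shows "sl2_geodesic UNIV (\<lambda>t. vector [x * sinh t, y * sinh t, 0])
                           (\<lambda>t. vector [x * cosh t, y * cosh t, 0])"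
proof -
  have 1: "1 + ((x * sinh t)\<^sup>2 + (y * sinh t)\<^sup>2) = (cosh t)\<^sup>2" for t
  proof -
    have "1 + ((x * sinh t)\<^sup>2 + (y * sinh t)\<^sup>2) = 1 + (x\<^sup>2 + y\<^sup>2) * (sinh t)\<^sup>2"
      by (simp only: power_mult_distrib distrib_right)
    then show ?thesis
      by (simp add: assms cosh_square_eq)
  qed
  have 2: "x * sinh t * (x * cosh t) + y * sinh t * (y * cosh t) = sinh t * cosh t" for t
    using assms by algebra
  have accel: "sl2_accel (vector [x * sinh t, y * sinh t, 0]) (vector [x * cosh t, y * cosh t, 0])
      = vector [x * sinh t, y * sinh t, 0]" for t
    by (simp add: sl2_accel_def Let_def sl2_form_def add.assoc 1 2 vec_eq_iff forall_3)
       (simp add: power2_eq_square)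
  have "((\<lambda>t. z * sinh t) has_real_derivative z * cosh t) (at t)"
    "((\<lambda>t. z * cosh t) has_real_derivative z * sinh t) (at t)" for z t :: real
    by (auto intro!: derivative_eq_intros)
  then show ?thesis
    unfolding sl2_geodesic_def has_vector_derivative_vec3_iff accel by simp
qed

text \<open>
  These are the helices through the axis: the orbit with \<open>\<mu> = e = - y\<close> and \<open>C = y\<close>, for which
  \<open>z\<^sub>0 = cos t - \<i> y sin t\<close> and \<open>z\<^sub>1 = (m + \<i> n) sin t\<close>. For \<open>y > 1\<close> they project to hyperbolic circles through the origin, return
  to the axis whenever \<open>sin t = 0\<close>, and are farthest from it when \<open>cos t = 0\<close>. As \<open>arg z\<^sub>0\<close> has to be
  followed over several turns, it is written as \<open>- t\<close> minus the argument of
  \<open>e\<^bsup>-\<i>t\<^esup> (cos t + \<i> y sin t)\<close>, whose real part \<open>D\<close> is positive; that argument vanishes at the two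
  kinds of points just mentioned.
\<close>

lemma axis_geodesic:
  fixes y m n h :: real
  assumes "y > 0" and mn: "m\<^sup>2 + n\<^sup>2 = y\<^sup>2 - 1"
  obtains c V where "sl2_geodesic UNIV c V"
    and "\<And>t. sl2_metric (c t) (V t) (V t) = 2 * y\<^sup>2 - 1"
    and "\<And>t. sin t = 0 \<Longrightarrow> c t = vector [0, 0, h + (2 * y - 1) * t]"
    and "\<And>t. sin t = 0 \<Longrightarrow> V t = vector [m, n, y]"
    and "\<And>t. cos t = 0 \<Longrightarrow> c t = vector [n, - m, h + (2 * y - 1) * t]"
    and "\<And>t. cos t = 0 \<Longrightarrow> V t = vector [- m / y, - n / y, 2 * y - 1 / y]"
proof -
  define a b p q where "a t = cos t" and "b t = - (y * sin t)" and "p t = m * sin t" and "q t = n * sin t" for t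
  define D where "D t = (cos t)\<^sup>2 + y * (sin t)\<^sup>2" for t
  define \<phi> where "\<phi> t = h + (2 * y - 1) * t - arctan ((y - 1) * (sin t * cos t) / D t)" for t
  have Dpos: "D t > 0" for t
    using sin_zero_abs_cos_one[of t] \<open>y > 0\<close> unfolding D_def
    by (cases "sin t = 0") (auto intro: add_nonneg_pos)
  have "(\<phi> has_real_derivative 2 * y + - y / ((a t)\<^sup>2 + (b t)\<^sup>2)) (at t)" for t
  proof -
    define F where "F t = (y - 1) * (sin t * cos t) / D t" for t
    define F' where "F' = ((y - 1) * ((cos t)\<^sup>2 - (sin t)\<^sup>2) * D t - (y - 1) * (sin t * cos t) * (2 * (y - 1) * (sin t * cos t))) / (D t * D t)"
    have "(D has_real_derivative 2 * (y - 1) * (sin t * cos t)) (at t)"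
      unfolding D_def[abs_def] by (auto intro!: derivative_eq_intros simp: algebra_simps)
    moreover have "((\<lambda>t. (y - 1) * (sin t * cos t)) has_real_derivative (y - 1) * ((cos t)\<^sup>2 - (sin t)\<^sup>2)) (at t)"
      by (auto intro!: derivative_eq_intros simp: algebra_simps power2_eq_square)
    ultimately have "(F has_real_derivative F') (at t)"
      unfolding F_def[abs_def] F'_def using Dpos[of t] by (intro DERIV_divide) auto
    then have d: "((\<lambda>t. arctan (F t)) has_real_derivative inverse (1 + (F t)\<^sup>2) * F') (at t)"
      by (rule DERIV_chain2[OF DERIV_arctan])
    define K where "K = (cos t)\<^sup>2 + (y * sin t)\<^sup>2"
    have sc: "(sin t)\<^sup>2 + (cos t)\<^sup>2 = 1" by simp
    have "D t * D t + ((y - 1) * (sin t * cos t))\<^sup>2 = K"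
      unfolding D_def K_def using sc by algebra
    then have F2: "1 + (F t)\<^sup>2 = K / (D t * D t)"
      using Dpos[of t] by (simp add: F_def field_simps power2_eq_square)
    have "F' = (y - K) / (D t * D t)"
    proof -
      have "(y - 1) * ((cos t)\<^sup>2 - (sin t)\<^sup>2) * D t - (y - 1) * (sin t * cos t) * (2 * (y - 1) * (sin t * cos t)) = y - K"
        unfolding D_def K_def using sc by algebra
      then show ?thesis
        by (simp add: F'_def)
    qed
    then have eq: "inverse (1 + (F t)\<^sup>2) * F' = (y - K) / K"
      using Dpos[of t] by (simp add: F2 field_simps)
    have "K > 0"
      using sin_zero_abs_cos_one[of t] \<open>y > 0\<close> unfolding K_def
      by (cases "sin t = 0") (auto intro: add_nonneg_pos)
    then have "(2 * y - 1) - (y - K) / K = 2 * y + - y / ((a t)\<^sup>2 + (b t)\<^sup>2)"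
      by (simp add: a_def b_def K_def[symmetric] diff_divide_distrib)
    moreover have "(\<phi> has_real_derivative (2 * y - 1) - (y - K) / K) (at t)"
      unfolding \<phi>_def[abs_def] F_def[symmetric]
      by (rule derivative_eq_intros d refl)+ (simp add: eq)
    ultimately show ?thesis
      by metis
  qed
  note orbit = orbit_geodesic[of a "- y" b m p n q "- y" y \<phi>, OF _ _ _ _ _ _ _ this]
  define N where "N t = sqrt ((a t)\<^sup>2 + (b t)\<^sup>2)" for t
  define c :: "real \<Rightarrow> real ^ 3" where "c t = vector [(p t * a t - q t * b t) / N t, (p t * b t + q t * a t) / N t, \<phi> t]" for t
  define V :: "real \<Rightarrow> real ^ 3" where "V t = vector
     [m * N t - (p t * b t + q t * a t) / N t * (- y + - y / (N t)\<^sup>2),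
      n * N t + (p t * a t - q t * b t) / N t * (- y + - y / (N t)\<^sup>2), 2 * y + - y / (N t)\<^sup>2]" for t
  have sc: "(sin t)\<^sup>2 + (cos t)\<^sup>2 = 1" for t :: real by simp
  have ders: "(a has_real_derivative - (- y) * b t + m * p t + n * q t) (at t)"
    "(b has_real_derivative - y * a t + n * p t - m * q t) (at t)"
    "(p has_real_derivative - (- y) * q t + m * a t + n * b t) (at t)"
    "(q has_real_derivative - y * p t + n * a t - m * b t) (at t)" for t
  proof -
    have "- (- y) * b t + m * p t + n * q t = - sin t"
      unfolding b_def p_def q_def using mn by algebra
    then show "(a has_real_derivative - (- y) * b t + m * p t + n * q t) (at t)"
      unfolding a_def[abs_def] using DERIV_cos[of t] by metis
    show "(b has_real_derivative - y * a t + n * p t - m * q t) (at t)"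
    "(p has_real_derivative - (- y) * q t + m * a t + n * b t) (at t)"
    "(q has_real_derivative - y * p t + n * a t - m * b t) (at t)"
      unfolding a_def[abs_def] b_def[abs_def] p_def[abs_def] q_def[abs_def]
      by (auto intro!: derivative_eq_intros)
  qed
  have norm: "(a t)\<^sup>2 + (b t)\<^sup>2 = 1 + (p t)\<^sup>2 + (q t)\<^sup>2" for t
    unfolding a_def b_def p_def q_def using mn sc[of t] by algebra
  have mom: "a t * (- y * a t + n * p t - m * q t) - b t * (- (- y) * b t + m * p t + n * q t) = - y" for t
    unfolding a_def b_def p_def q_def using mn sc[of t] by algebra
  show thesis
  proof (rule that[of c V])
    show "sl2_geodesic UNIV c V"
      unfolding c_def[abs_def] V_def[abs_def] N_def
      by (rule orbit(1)) (use ders norm mom in auto)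
    show "sl2_metric (c t) (V t) (V t) = 2 * y\<^sup>2 - 1" for t
    proof -
      have "sl2_metric (c t) (V t) (V t) = m\<^sup>2 + n\<^sup>2 + 4 * - y * (- y - - y) + y\<^sup>2"
        unfolding c_def V_def N_def by (rule orbit(2)) (use ders norm mom in auto)
      then show ?thesis
        by (simp add: mn)
    qed
  next
    fix t :: real assume s: "sin t = 0"
    then have "N t = 1"
      using sc[of t] by (simp add: N_def a_def b_def)
    then show "c t = vector [0, 0, h + (2 * y - 1) * t]" "V t = vector [m, n, y]"
      using s by (simp_all add: c_def V_def \<phi>_def p_def q_def)
  next
    fix t :: real assume s: "cos t = 0"
    have s2: "sin t * sin t = 1"
      using sc[of t] s by (simp add: power2_eq_square)
    then have "(a t)\<^sup>2 + (b t)\<^sup>2 = y\<^sup>2"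
      by (simp add: a_def b_def s power2_eq_square mult_ac)
    then have "N t = y"
      using \<open>y > 0\<close> by (simp add: N_def)
    then show "c t = vector [n, - m, h + (2 * y - 1) * t]" "V t = vector [- m / y, - n / y, 2 * y - 1 / y]"
      using s \<open>y > 0\<close> s2
      by (simp_all add: c_def V_def \<phi>_def p_def q_def a_def b_def vec_eq_iff forall_3 field_simps power2_eq_square)
  qed
qed

text \<open>
  The orbit with \<open>z\<^sub>0 = \<gamma> cosh t - \<i> X sinh t\<close> and \<open>z\<^sub>1 = \<sigma> cosh t + \<i> Y sinh t\<close> starts at
  \<open>(\<sigma>, 0, 0)\<close> and is symmetric under \<open>t \<mapsto> - t\<close>, \<open>(u, v, \<phi>) \<mapsto> (u, - v, - \<phi>)\<close>. Its height is the
  sum of \<open>2 C t\<close> and of \<open>arg z\<^sub>0\<close>, which have opposite signs; the condition on \<open>T\<close> says that they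
  cancel at the times \<open>T\<close> and \<open>- T\<close>. Since \<open>m = 0\<close>, the radial velocity is governed by \<open>n\<close> and the
  coordinate \<open>v\<close> alone.
\<close>

lemma arch_geodesic:
  fixes C s \<gamma> \<sigma> T :: real
  assumes s: "s\<^sup>2 = 1 + C\<^sup>2" "s > 0" and hyp: "\<gamma>\<^sup>2 = 1 + \<sigma>\<^sup>2" "\<gamma> > 0" "\<sigma> > 0" and "C > 0" "T > 0"
    and T: "2 * C * T = arctan ((C * \<gamma> + s * \<sigma>) / \<gamma> * tanh T)"
  obtains c V x y where "sl2_geodesic UNIV c V" and "x > 0" "y > 0"
    and "c T = vector [x, y, 0]" "c (- T) = vector [x, - y, 0]"
    and "\<And>t. sl2_metric (c t) (V t) (V t) = s\<^sup>2 + C\<^sup>2"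
    and "\<And>t. c t $ 1 * V t $ 1 + c t $ 2 * V t $ 2
      = sqrt (1 + (c t $ 1)\<^sup>2 + (c t $ 2)\<^sup>2) * ((2 * C * \<sigma> * \<gamma> + s * (\<gamma>\<^sup>2 + \<sigma>\<^sup>2)) * c t $ 2)"
proof -
  define X where "X = C * \<gamma> + s * \<sigma>"
  define Y where "Y = C * \<sigma> + s * \<gamma>"
  define n where "n = X * \<sigma> + Y * \<gamma>"
  define \<mu> where "\<mu> = - (X * \<gamma> + Y * \<sigma>)"
  define e where "e = - (X * \<gamma>)"
  define a b p q where "a t = \<gamma> * cosh t" and "b t = - (X * sinh t)" and "p t = \<sigma> * cosh t" and "q t = Y * sinh t" for t
  define \<phi> where "\<phi> t = 2 * C * t + arctan (b t / a t)" for t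
  have XY: "Y\<^sup>2 = X\<^sup>2 + 1"
    unfolding X_def Y_def using s hyp(1) by algebra
  have hyp_t: "(cosh t)\<^sup>2 = 1 + (sinh t)\<^sup>2" for t :: real
    by (simp add: cosh_square_eq)
  have ders: "(a has_real_derivative - \<mu> * b t + 0 * p t + n * q t) (at t)"
    "(b has_real_derivative \<mu> * a t + n * p t - 0 * q t) (at t)"
    "(p has_real_derivative - \<mu> * q t + 0 * a t + n * b t) (at t)"
    "(q has_real_derivative \<mu> * p t + n * a t - 0 * b t) (at t)" for t
  proof -
    have eqs: "- \<mu> * b t + 0 * p t + n * q t = \<gamma> * sinh t"
      "\<mu> * a t + n * p t - 0 * q t = - (X * cosh t)"
      "- \<mu> * q t + 0 * a t + n * b t = \<sigma> * sinh t"
      "\<mu> * p t + n * a t - 0 * b t = Y * cosh t"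
      unfolding \<mu>_def n_def a_def b_def p_def q_def using XY hyp(1) by algebra+
    show "(a has_real_derivative - \<mu> * b t + 0 * p t + n * q t) (at t)"
      "(b has_real_derivative \<mu> * a t + n * p t - 0 * q t) (at t)"
      "(p has_real_derivative - \<mu> * q t + 0 * a t + n * b t) (at t)"
      "(q has_real_derivative \<mu> * p t + n * a t - 0 * b t) (at t)"
      unfolding eqs unfolding a_def[abs_def] b_def[abs_def] p_def[abs_def] q_def[abs_def]
      by (auto intro!: derivative_eq_intros)
  qed
  have norm: "(a t)\<^sup>2 + (b t)\<^sup>2 = 1 + (p t)\<^sup>2 + (q t)\<^sup>2" for t
    unfolding a_def b_def p_def q_def using XY hyp(1) hyp_t[of t] by algebra
  have mom: "a t * (\<mu> * a t + n * p t - 0 * q t) - b t * (- \<mu> * b t + 0 * p t + n * q t) = e" for t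
    unfolding a_def b_def p_def q_def e_def \<mu>_def n_def using XY hyp(1) hyp_t[of t] by algebra
  have \<mu>: "\<mu> = C + 2 * e"
    unfolding \<mu>_def e_def X_def Y_def using hyp(1) by algebra
  have apos: "a t > 0" for t
    using \<open>\<gamma> > 0\<close> by (simp add: a_def)
  have d\<phi>: "(\<phi> has_real_derivative 2 * C + e / ((a t)\<^sup>2 + (b t)\<^sup>2)) (at t)" for t
  proof -
    define F' where "F' = ((\<mu> * a t + n * p t - 0 * q t) * a t - b t * (- \<mu> * b t + 0 * p t + n * q t)) / (a t * a t)"
    have "((\<lambda>t. b t / a t) has_real_derivative F') (at t)"
      unfolding F'_def using apos[of t] by (intro DERIV_divide ders) auto
    then have d: "((\<lambda>t. arctan (b t / a t)) has_real_derivative inverse (1 + (b t / a t)\<^sup>2) * F') (at t)"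
      by (rule DERIV_chain2[OF DERIV_arctan])
    have "F' = e / (a t * a t)"
      unfolding F'_def using mom[of t] by (simp add: mult.commute)
    moreover have "1 + (b t / a t)\<^sup>2 = ((a t)\<^sup>2 + (b t)\<^sup>2) / (a t * a t)"
      using apos[of t] by (simp add: field_simps power2_eq_square)
    ultimately have "inverse (1 + (b t / a t)\<^sup>2) * F' = e / ((a t)\<^sup>2 + (b t)\<^sup>2)"
      using apos[of t] by simp
    moreover have "((\<lambda>t. 2 * C * t) has_real_derivative 2 * C) (at t)"
      by (auto intro!: derivative_eq_intros)
    ultimately show ?thesis
      unfolding \<phi>_def[abs_def] using DERIV_add d by metis
  qed
  note orbit = orbit_geodesic[of a \<mu> b 0 p n q e C \<phi>, OF ders norm mom \<mu> d\<phi>]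
  define N where "N t = sqrt ((a t)\<^sup>2 + (b t)\<^sup>2)" for t
  define u v where "u t = (p t * a t - q t * b t) / N t" and "v t = (p t * b t + q t * a t) / N t" for t
  define c :: "real \<Rightarrow> real ^ 3" where "c t = vector [u t, v t, \<phi> t]" for t
  define V :: "real \<Rightarrow> real ^ 3" where "V t = vector
     [0 * N t - v t * (\<mu> + e / (N t)\<^sup>2), n * N t + u t * (\<mu> + e / (N t)\<^sup>2), 2 * C + e / (N t)\<^sup>2]" for t
  have Npos: "N t > 0" for t
    unfolding N_def norm by (simp add: add_pos_nonneg)
  have Xpos: "X > 0" and Ypos: "Y > 0"
    unfolding X_def Y_def using assms by (auto intro!: add_pos_pos mult_pos_pos)
  have bT: "b T / a T = - (X / \<gamma> * tanh T)"
    using \<open>\<gamma> > 0\<close> by (simp add: a_def b_def tanh_def)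
  then have \<phi>T: "\<phi> T = 0"
    using T by (simp add: \<phi>_def arctan_minus X_def[symmetric])
  have even: "N (- T) = N T" "u (- T) = u T" "v (- T) = - v T" "\<phi> (- T) = - \<phi> T"
  proof -
    have parity: "a (- T) = a T" "b (- T) = - b T" "p (- T) = p T" "q (- T) = - q T"
      by (simp_all add: a_def b_def p_def q_def)
    show N: "N (- T) = N T"
      by (simp add: N_def parity)
    show "u (- T) = u T" "v (- T) = - v T" "\<phi> (- T) = - \<phi> T"
      by (simp_all add: u_def v_def \<phi>_def parity N add_divide_distrib diff_divide_distrib arctan_minus)
  qed
  show thesis
  proof (rule that[of c V "u T" "v T"])
    show "sl2_geodesic UNIV c V"
      unfolding c_def[abs_def] V_def[abs_def] N_def u_def v_def by (rule orbit(1))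
    show "u T > 0"
      unfolding u_def using Npos[of T] Xpos Ypos assms
      by (auto simp: a_def b_def p_def q_def intro!: divide_pos_pos add_pos_pos mult_pos_pos)
    have "p T * b T + q T * a T = s * cosh T * sinh T"
      unfolding a_def b_def p_def q_def X_def Y_def using hyp(1) by algebra
    then show "v T > 0"
      unfolding v_def using Npos[of T] \<open>s > 0\<close> \<open>T > 0\<close> by (simp add: divide_pos_pos)
    show "c T = vector [u T, v T, 0]" "c (- T) = vector [u T, - v T, 0]"
      by (simp_all add: c_def even \<phi>T)
    show "sl2_metric (c t) (V t) (V t) = s\<^sup>2 + C\<^sup>2" for t
    proof -
      have "sl2_metric (c t) (V t) (V t) = 0\<^sup>2 + n\<^sup>2 + 4 * e * (e - \<mu>) + C\<^sup>2"
        unfolding c_def V_def N_def u_def v_def by (rule orbit(2))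
      moreover have "n\<^sup>2 + 4 * e * (e - \<mu>) = s\<^sup>2"
        unfolding n_def e_def \<mu>_def X_def Y_def using hyp(1) by algebra
      ultimately show ?thesis
        by simp
    qed
    have n: "2 * C * \<sigma> * \<gamma> + s * (\<gamma>\<^sup>2 + \<sigma>\<^sup>2) = n"
      unfolding n_def X_def Y_def by algebra
    have "u t * V t $ 1 + v t * V t $ 2 = N t * (0 * u t + n * v t)" for t
      unfolding V_def N_def u_def v_def by (rule orbit(3))
    moreover have "(N t)\<^sup>2 = 1 + (u t)\<^sup>2 + (v t)\<^sup>2" for t
      unfolding N_def u_def v_def by (rule orbit(4))
    then have "N t = sqrt (1 + (u t)\<^sup>2 + (v t)\<^sup>2)" for t
      using Npos[of t] by (metis less_imp_le real_sqrt_unique)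
    ultimately show "c t $ 1 * V t $ 1 + c t $ 2 * V t $ 2
      = sqrt (1 + (c t $ 1)\<^sup>2 + (c t $ 2)\<^sup>2) * ((2 * C * \<sigma> * \<gamma> + s * (\<gamma>\<^sup>2 + \<sigma>\<^sup>2)) * c t $ 2)" for t
      unfolding n by (simp add: c_def)
  qed
qed

text \<open>
  For \<open>T = 1\<close> and \<open>C = \<pi> / 8\<close> the left-hand side of the height condition is \<open>\<pi> / 4 = arctan 1\<close>, so it
  becomes linear in \<open>D = \<sigma> / \<gamma>\<close>. The solution lies between \<open>1/2\<close> and \<open>1\<close>: below \<open>1\<close> it is the
  hyperbolic tangent of a distance, and above \<open>1/2\<close> it makes the coefficient \<open>n\<close> of the arch exceed its
  speed \<open>sqrt (s\<^sup>2 + C\<^sup>2)\<close>.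
\<close>

lemma arch_parameters:
  obtains C s \<gamma> \<sigma> :: real where "s\<^sup>2 = 1 + C\<^sup>2" "s > 0" "\<gamma>\<^sup>2 = 1 + \<sigma>\<^sup>2" "\<gamma> > 0" "\<sigma> > 0" "C > 0"
    "2 * C = arctan ((C * \<gamma> + s * \<sigma>) / \<gamma> * tanh 1)"
    "sqrt (s\<^sup>2 + C\<^sup>2) < 2 * C * \<sigma> * \<gamma> + s * (\<gamma>\<^sup>2 + \<sigma>\<^sup>2)"
proof -
  define C :: real where "C = pi / 8"
  define s where "s = sqrt (1 + C\<^sup>2)"
  define h :: real where "h = 1 / tanh 1"
  define D where "D = (h - C) / s"
  define \<gamma> where "\<gamma> = 1 / sqrt (1 - D\<^sup>2)"
  define \<sigma> where "\<sigma> = D * \<gamma>"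
  have C: "3/8 < C" "C < 2/5"
    using pi_gt3 pi_less_4 pi_approx by (auto simp: C_def)
  have s2: "s\<^sup>2 = 1 + C\<^sup>2" and spos: "s > 0"
    by (auto simp: s_def add_pos_nonneg)
  have "C\<^sup>2 < (2/5)\<^sup>2" "(3/8)\<^sup>2 < C\<^sup>2"
    using C by (auto intro!: power_strict_mono)
  then have "s\<^sup>2 < (6/5)\<^sup>2" "(21/20)\<^sup>2 < s\<^sup>2"
    unfolding s2 by (auto simp: power2_eq_square)
  then have s: "21/20 < s" "s < 6/5"
    using spos power2_less_imp_less[of s "6/5"] power2_less_imp_less[of "21/20" s] by simp_all
  have "exp 1 \<ge> (5/2 :: real)"
    using exp_lower_Taylor_quadratic[of 1] by simp
  then have exp2: "exp 2 \<ge> (25/4 :: real)"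
    using power_mono[of "5/2" "exp 1 :: real" 2] exp_add[of 1 "1 :: real"] by (simp add: power2_eq_square)
  define E :: real where "E = exp (- 2)"
  have E: "E > 0" "E \<le> 4/25"
    using exp2 by (simp_all add: E_def exp_minus field_simps)
  have hE: "h = (1 + E) / (1 - E)"
    using tanh_real_altdef[of 1] by (simp add: h_def E_def)
  have "1 - E > 0"
    using E by simp
  then have h: "1 < h" "h \<le> 29/21"
    unfolding hE using E by (simp_all add: pos_less_divide_eq pos_divide_le_eq)
  have D: "1/2 < D" "D < 1"
    unfolding D_def using C s h spos by (auto simp: field_simps)
  have D2: "1/4 < D\<^sup>2" "D\<^sup>2 < 1"
    using power_strict_mono[of "1/2" D 2] power_strict_mono[of D 1 2] D by (auto simp: power2_eq_square)
  have \<gamma>pos: "\<gamma> > 0"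
    using D2 by (simp add: \<gamma>_def)
  have \<gamma>2: "\<gamma>\<^sup>2 * (1 - D\<^sup>2) = 1"
    using D2 by (simp add: \<gamma>_def power_divide)
  have \<gamma>43: "\<gamma>\<^sup>2 > 4/3"
  proof -
    have "\<gamma>\<^sup>2 = 1 / (1 - D\<^sup>2)"
      using D2 by (simp add: \<gamma>_def power_divide)
    moreover have "4 / 3 < 1 / (1 - D\<^sup>2)"
      using D2 by (simp add: pos_less_divide_eq)
    ultimately show ?thesis
      by metis
  qed
  have "sqrt (s\<^sup>2 + C\<^sup>2) \<le> s + C"
    using C spos by (intro real_le_lsqrt) (auto simp: power2_sum)
  also have "s + C < (4/3) * (C + s * (5/4))"
    using C spos by simp
  also have "\<dots> < \<gamma>\<^sup>2 * (C + s * (5/4))"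
    using \<gamma>43 C spos by (intro mult_strict_right_mono) auto
  also have "\<dots> \<le> \<gamma>\<^sup>2 * (2 * C * D + s * (1 + D\<^sup>2))"
    using D D2 C spos by (intro mult_left_mono add_mono) auto
  also have "\<dots> = 2 * C * \<sigma> * \<gamma> + s * (\<gamma>\<^sup>2 + \<sigma>\<^sup>2)"
    unfolding \<sigma>_def by algebra
  finally have large: "sqrt (s\<^sup>2 + C\<^sup>2) < 2 * C * \<sigma> * \<gamma> + s * (\<gamma>\<^sup>2 + \<sigma>\<^sup>2)" .
  have "(C * \<gamma> + s * \<sigma>) / \<gamma> = C + s * D"
    using \<gamma>pos by (simp add: \<sigma>_def field_simps)
  also have "\<dots> = h"
    using spos by (simp add: D_def)
  finally have "(C * \<gamma> + s * \<sigma>) / \<gamma> * tanh 1 = 1"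
    by (simp add: h_def)
  then have closing: "2 * C = arctan ((C * \<gamma> + s * \<sigma>) / \<gamma> * tanh 1)"
    by (simp add: C_def arctan_one)
  have hyp: "\<gamma>\<^sup>2 = 1 + \<sigma>\<^sup>2"
    unfolding \<sigma>_def using \<gamma>2 by algebra
  have "\<sigma> > 0"
    using D \<gamma>pos by (simp add: \<sigma>_def)
  then show thesis
    using that s2 spos hyp \<gamma>pos C closing large by auto
qed

section \<open>Triangles with angle sum at least \<open>\<pi>\<close>\<close>

lemma sl2_metric_axis:
  "p $ 1 = 0 \<Longrightarrow> p $ 2 = 0 \<Longrightarrow> sl2_metric p X Y = X $ 1 * Y $ 1 + X $ 2 * Y $ 2 + X $ 3 * Y $ 3"
  by (simp add: sl2_metric_def sl2_form_def)

lemma sl2_metric_radial: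
  "sl2_metric p V (vector [r * p $ 1, r * p $ 2, 0])
    = r * (p $ 1 * V $ 1 + p $ 2 * V $ 2) / (1 + (p $ 1)\<^sup>2 + (p $ 2)\<^sup>2)"
  by (simp add: sl2_metric_def sl2_form_def algebra_simps)

text \<open>
  Two vertices lie on the axis, the third one at distance \<open>arsinh a\<close> from it. The sides at the third
  vertex are a horizontal radial one and the helix with \<open>y = 3 / 2\<close>, followed for one and a half of its
  loops, which ends at its point farthest from the axis and so meets the radial side at a right angle.
  It climbs at the mean rate \<open>2 y - 1 = 2\<close> for the time \<open>3 \<pi> / 2\<close>, whence the height \<open>3 \<pi>\<close>. The third
  side is left open.
\<close>

lemma triangle_with_axis_side:
  defines "a \<equiv> sqrt 5 / 2"
  assumes c31: "sl2_geodesic UNIV d W" "d s = vector [0, 0, 3 * pi]" "d s' = 0" "s' < s"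
  obtains c12 c23 where
    "geodesic_triangle sl2_metric 0 (vector [a, 0, 0]) (vector [0, 0, 3 * pi]) c12 c23 (subarc d s s')"
    "interior_angle_sum sl2_metric c12 c23 (subarc d s s') =
      arccos (W s' $ 1 / sqrt (sl2_metric 0 (W s') (W s'))) + pi / 2
      + arccos ((a * W s $ 2 + 3 / 2 * W s $ 3) / (sqrt (sl2_metric (d s) (W s) (W s)) * sqrt (7 / 2)))"
proof -
  have a2: "a\<^sup>2 = 5 / 4" and apos: "a > 0"
    by (simp_all add: a_def power_divide)
  define r :: "real \<Rightarrow> real ^ 3" where "r t = vector [1 * sinh t, 0 * sinh t, 0]" for t
  define R :: "real \<Rightarrow> real ^ 3" where "R t = vector [1 * cosh t, 0 * cosh t, 0]" for t
  define \<tau> where "\<tau> = arsinh a"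
  have \<tau>: "sinh \<tau> = a" "\<tau> > 0"
    using apos by (simp_all add: \<tau>_def)
  have r: "sl2_geodesic UNIV r R"
    unfolding r_def[abs_def] R_def[abs_def] by (rule radial_geodesic) simp
  obtain c V where c: "sl2_geodesic UNIV c V" "\<And>t. sl2_metric (c t) (V t) (V t) = 7 / 2"
    and c0: "\<And>t. sin t = 0 \<Longrightarrow> c t = vector [0, 0, 3 * pi + 2 * t]"
      "\<And>t. sin t = 0 \<Longrightarrow> V t = vector [0, a, 3 / 2]"
    and c1: "\<And>t. cos t = 0 \<Longrightarrow> c t = vector [a, 0, 3 * pi + 2 * t]"
      "\<And>t. cos t = 0 \<Longrightarrow> V t = vector [0, - a / (3 / 2), 2 * (3 / 2) - 1 / (3 / 2)]"
    by (rule axis_geodesic[of "3 / 2" 0 a "3 * pi"]) (use a2 in \<open>auto simp: power_divide\<close>)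
  define t0 where "t0 = - (3 * pi / 2)"
  have "cos t0 = 0"
    unfolding t0_def using cos_3over2_pi by simp
  then have ct0: "c t0 = vector [a, 0, 0]" and Vt0: "V t0 $ 1 = 0" "V t0 $ 2 = - a / (3 / 2)"
    using c1[of t0] by (simp_all add: t0_def)
  have cz: "c 0 = vector [0, 0, 3 * pi]" "V 0 = vector [0, a, 3 / 2]"
    using c0[of 0] by simp_all
  have r0: "r 0 = 0" "r \<tau> = vector [a, 0, 0]" "R 0 = vector [1, 0, 0]"
    by (simp_all add: r_def R_def \<tau> vec_eq_iff forall_3)
  have t0: "t0 < 0"
    by (simp add: t0_def)
  have "geodesic_triangle sl2_metric 0 (vector [a, 0, 0]) (vector [0, 0, 3 * pi])
      (subarc r 0 \<tau>) (subarc c t0 0) (subarc d s s')"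
    unfolding geodesic_triangle_def
    using geodesic_segment_subarc[OF r] geodesic_segment_subarc[OF c(1)] geodesic_segment_subarc[OF c31(1)]
      r0 ct0 cz c31 apos
      not_on_common_geodesic_origin[of "vector [a, 0, 0]" "vector [0, 0, 3 * pi]"]
    by (auto simp: vec_eq_iff forall_3)
  moreover have "angle_between sl2_metric (subarc r 0 \<tau>) (subarc d s' s)
      = arccos (W s' $ 1 / sqrt (sl2_metric 0 (W s') (W s')))"
    unfolding angle_between_subarc[OF r c31(1)] using \<tau> c31(4)
    by (simp add: r0 sl2_metric_axis)
  moreover have "angle_between sl2_metric (subarc c t0 0) (subarc r \<tau> 0) = pi / 2"
  proof -
    have "sl2_metric (c t0) (V t0) (R \<tau>) = 0"
      using sl2_metric_radial[of "c t0" "V t0" "cosh \<tau> / a"] apos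
      by (simp add: ct0 Vt0 R_def)
    then show ?thesis
      unfolding angle_between_subarc[OF c(1) r] by simp
  qed
  moreover have "angle_between sl2_metric (subarc d s s') (subarc c 0 t0)
      = arccos ((a * W s $ 2 + 3 / 2 * W s $ 3) / (sqrt (sl2_metric (d s) (W s) (W s)) * sqrt (7 / 2)))"
  proof -
    have VV: "sl2_metric (d s) (V 0) (V 0) = 7 / 2"
      using c(2)[of 0] c31(2) cz(1) by simp
    have WV: "sl2_metric (d s) (W s) (V 0) = a * W s $ 2 + 3 / 2 * W s $ 3"
      by (simp add: c31(2) sl2_metric_axis cz)
    show ?thesis
      unfolding angle_between_subarc[OF c31(1) c(1)] VV WV using c31(4) t0 by simp
  qed
  ultimately show thesis
    using that[of "subarc r 0 \<tau>" "subarc c t0 0"]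
    unfolding interior_angle_sum_def reversepath_subarc by simp
qed

text \<open>
  The third side is the fibre; it is orthogonal to the radial side at the origin.
\<close>

lemma triangle_sum_greater:
  "\<exists>A1 A2 A3 c12 c23 c31. geodesic_triangle sl2_metric A1 A2 A3 c12 c23 c31 \<and>
     interior_angle_sum sl2_metric c12 c23 c31 > pi"
proof -
  let ?d = "\<lambda>t. vector [0, 0, t] :: real ^ 3" and ?W = "\<lambda>t. vector [0, 0, 1] :: real ^ 3"
  let ?x = "(3 / 2) / sqrt (7 / 2) :: real"
  obtain A2 c12 c23 where tri: "geodesic_triangle sl2_metric 0 A2 (vector [0, 0, 3 * pi]) c12 c23 (subarc ?d (3 * pi) 0)"
    and sum: "interior_angle_sum sl2_metric c12 c23 (subarc ?d (3 * pi) 0) = pi / 2 + pi / 2 + arccos ?x"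
    by (rule triangle_with_axis_side[OF fibre_geodesic, of "3 * pi" 0]) (auto simp: sl2_metric_axis vec_eq_iff forall_3)
  have "3 / 2 < sqrt (7 / 2)"
    by (rule real_less_rsqrt) (simp add: power2_eq_square)
  then have "arccos ?x > 0"
    using arccos_lt_bounded[of ?x] by (simp add: field_simps)
  then show ?thesis
    using tri sum by (metis add.commute field_sum_of_halves less_add_same_cancel1)
qed

text \<open>
  The third side is one loop of the helix with \<open>y = 2\<close>, which climbs to the same height
  \<open>(2 y - 1) \<pi> = 3 \<pi>\<close>. Its direction on the axis is
  \<open>(m, n, 2) = m (1, 0, 0) + (4 / 3) (0, sqrt 5 / 2, 3 / 2)\<close>, a combination with positive
  coefficients of the directions of the two other sides on the axis, which are orthogonal. So the
  angles at the axis add up to a right angle.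
\<close>

lemma triangle_sum_equal:
  "\<exists>A1 A2 A3 c12 c23 c31. geodesic_triangle sl2_metric A1 A2 A3 c12 c23 c31 \<and>
     interior_angle_sum sl2_metric c12 c23 c31 = pi"
proof -
  define m n where "m = sqrt 7 / 3" and "n = 2 * sqrt 5 / 3"
  have mn: "m\<^sup>2 + n\<^sup>2 = 2\<^sup>2 - 1"
    by (simp add: m_def n_def power_divide power_mult_distrib)
  obtain d W where d: "sl2_geodesic UNIV d W" "\<And>t. sl2_metric (d t) (W t) (W t) = 7"
    and d0: "\<And>t. sin t = 0 \<Longrightarrow> d t = vector [0, 0, 3 * t]" "\<And>t. sin t = 0 \<Longrightarrow> W t = vector [m, n, 2]"
    by (rule axis_geodesic[of 2 m n 0]) (use mn in auto)
  have dp: "d pi = vector [0, 0, 3 * pi]" "d 0 = 0"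
    using d0(1)[of pi] d0(1)[of 0] by (simp_all add: vec_eq_iff forall_3)
  obtain A2 c12 c23 where tri: "geodesic_triangle sl2_metric 0 A2 (vector [0, 0, 3 * pi]) c12 c23 (subarc d pi 0)"
    and sum: "interior_angle_sum sl2_metric c12 c23 (subarc d pi 0) =
      arccos (W 0 $ 1 / sqrt (sl2_metric 0 (W 0) (W 0))) + pi / 2
      + arccos ((sqrt 5 / 2 * W pi $ 2 + 3 / 2 * W pi $ 3) / (sqrt (sl2_metric (d pi) (W pi) (W pi)) * sqrt (7 / 2)))"
    by (rule triangle_with_axis_side[OF d(1) dp]) auto
  have first: "W 0 $ 1 / sqrt (sl2_metric 0 (W 0) (W 0)) = 1 / 3"
    using d(2)[of 0] d0(2)[of 0] dp(2) by (simp add: m_def)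
  have third: "(sqrt 5 / 2 * W pi $ 2 + 3 / 2 * W pi $ 3) / (sqrt (sl2_metric (d pi) (W pi) (W pi)) * sqrt (7 / 2))
      = sqrt (1 - (1 / 3)\<^sup>2)"
  proof -
    have "sqrt 5 / 2 * W pi $ 2 + 3 / 2 * W pi $ 3 = 14 / 3"
      using d0(2)[of pi] by (simp add: n_def)
    moreover have "sqrt 7 * sqrt (7 / 2) * sqrt (1 - (1 / 3)\<^sup>2) = sqrt ((14 / 3)\<^sup>2)"
      unfolding real_sqrt_mult[symmetric] by (simp add: power2_eq_square)
    then have "sqrt 7 * sqrt (7 / 2) * sqrt (1 - (1 / 3)\<^sup>2) = 14 / 3"
      by simp
    ultimately show ?thesis
      using d(2)[of pi] by (simp add: field_simps)
  qed
  have "interior_angle_sum sl2_metric c12 c23 (subarc d pi 0) =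
      arccos (1 / 3) + pi / 2 + arcsin (1 / 3)"
    unfolding sum first third using arcsin_arccos_sqrt_pos[of "1 / 3"] by simp
  then have "interior_angle_sum sl2_metric c12 c23 (subarc d pi 0) = pi"
    using arcsin_arccos_eq[of "1 / 3"] by simp
  then show ?thesis
    using tri by blast
qed

section \<open>A triangle with angle sum below \<open>\<pi>\<close>\<close>

text \<open>
  Both legs are horizontal radii of length \<open>\<tau>\<close> and the base is an arch. With \<open>\<eta>\<close> the sine of half of
  the apex angle, each base angle has cosine \<open>\<nu> * \<eta> / E\<close>, where \<open>E\<close> is the speed of the arch. In the
  borderline case \<open>\<nu> = E\<close> the base angle and half of the apex angle would be complementary; here
  \<open>E < \<nu>\<close>.
\<close>

lemma triangle_sum_less:
  "\<exists>A1 A2 A3 c12 c23 c31. geodesic_triangle sl2_metric A1 A2 A3 c12 c23 c31 \<and>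
     interior_angle_sum sl2_metric c12 c23 c31 < pi"
proof -
  obtain C s \<gamma> \<sigma> :: real where par: "s\<^sup>2 = 1 + C\<^sup>2" "s > 0" "\<gamma>\<^sup>2 = 1 + \<sigma>\<^sup>2" "\<gamma> > 0" "\<sigma> > 0" "C > 0"
    "2 * C = arctan ((C * \<gamma> + s * \<sigma>) / \<gamma> * tanh 1)"
    and large: "sqrt (s\<^sup>2 + C\<^sup>2) < 2 * C * \<sigma> * \<gamma> + s * (\<gamma>\<^sup>2 + \<sigma>\<^sup>2)"
    by (rule arch_parameters)
  define E where "E = sqrt (s\<^sup>2 + C\<^sup>2)"
  define \<nu> where "\<nu> = 2 * C * \<sigma> * \<gamma> + s * (\<gamma>\<^sup>2 + \<sigma>\<^sup>2)"
  have E: "E > 0" "E < \<nu>" "E\<^sup>2 = s\<^sup>2 + C\<^sup>2"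
    using large par(2) by (simp_all add: E_def \<nu>_def add_pos_nonneg)
  have closing: "2 * C * 1 = arctan ((C * \<gamma> + s * \<sigma>) / \<gamma> * tanh 1)"
    using par(7) by simp
  obtain c V x y where c: "sl2_geodesic UNIV c V" and xy: "x > 0" "y > 0"
    and cT: "c 1 = vector [x, y, 0]" "c (- 1) = vector [x, - y, 0]"
    and speed: "\<And>t. sl2_metric (c t) (V t) (V t) = s\<^sup>2 + C\<^sup>2"
    and rad: "\<And>t. c t $ 1 * V t $ 1 + c t $ 2 * V t $ 2
      = sqrt (1 + (c t $ 1)\<^sup>2 + (c t $ 2)\<^sup>2) * (\<nu> * c t $ 2)"
    by (rule arch_geodesic[OF par(1-6) zero_less_one closing, folded \<nu>_def]) (rule that)
  define \<rho> where "\<rho> = sqrt (x\<^sup>2 + y\<^sup>2)"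
  have \<rho>: "\<rho>\<^sup>2 = x\<^sup>2 + y\<^sup>2" "\<rho> > 0"
    using xy by (simp_all add: \<rho>_def add_pos_pos)
  define N where "N = sqrt (1 + x\<^sup>2 + y\<^sup>2)"
  have N: "N\<^sup>2 = 1 + x\<^sup>2 + y\<^sup>2" "N > 0"
    by (simp_all add: N_def add_pos_nonneg)
  define \<tau> where "\<tau> = arsinh \<rho>"
  have \<tau>: "sinh \<tau> = \<rho>" "\<tau> > 0" "cosh \<tau> = N"
    using \<rho> by (simp_all add: \<tau>_def N_def cosh_arsinh_real add_ac)
  define r :: "real \<Rightarrow> real \<Rightarrow> real ^ 3" where "r z t = vector [x / \<rho> * sinh t, z / \<rho> * sinh t, 0]" for z t
  define R :: "real \<Rightarrow> real \<Rightarrow> real ^ 3" where "R z t = vector [x / \<rho> * cosh t, z / \<rho> * cosh t, 0]" for z t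
  have unit: "(x / \<rho>)\<^sup>2 + (z / \<rho>)\<^sup>2 = 1" if "z\<^sup>2 = y\<^sup>2" for z
    unfolding power_divide that add_divide_distrib[symmetric] \<rho>(1)[symmetric] using \<rho>(2) by simp
  have r: "sl2_geodesic UNIV (r z) (R z)" if "z\<^sup>2 = y\<^sup>2" for z
    unfolding r_def[abs_def] R_def[abs_def]
    by (rule radial_geodesic[OF unit[OF that]])
  note r1 = r[of y, OF refl] and r2 = r[of "- y", simplified]
  have r0: "r z 0 = 0" "r z \<tau> = vector [x, z, 0]" "R z 0 = vector [x / \<rho>, z / \<rho>, 0]" for z
    using \<rho> by (simp_all add: r_def R_def \<tau> vec_eq_iff forall_3)
  define \<eta> where "\<eta> = y / \<rho>"
  have \<eta>: "0 < \<eta>" "\<eta> < 1"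
  proof -
    have "y\<^sup>2 < \<rho>\<^sup>2"
      using xy by (simp add: \<rho>)
    then have "y < \<rho>"
      using \<rho>(2) power2_less_imp_less[of y \<rho>] by simp
    then show "0 < \<eta>" "\<eta> < 1"
      using xy \<rho> by (simp_all add: \<eta>_def)
  qed
  have apex: "angle_between sl2_metric (subarc (r (- y)) 0 \<tau>) (subarc (r y) 0 \<tau>) = 2 * arcsin \<eta>"
  proof -
    have "angle_between sl2_metric (subarc (r (- y)) 0 \<tau>) (subarc (r y) 0 \<tau>) = arccos ((x / \<rho>)\<^sup>2 - (y / \<rho>)\<^sup>2)"
      unfolding angle_between_subarc[OF r2 r1] using \<tau> unit[of y]
      by (simp add: r0 sl2_metric_axis power2_eq_square)
    also have "(x / \<rho>)\<^sup>2 - (y / \<rho>)\<^sup>2 = cos (2 * arcsin \<eta>)"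
      using unit[of y] \<eta> by (simp add: cos_double_sin \<eta>_def)
    also have "arccos (cos (2 * arcsin \<eta>)) = 2 * arcsin \<eta>"
      using \<eta> arcsin_lt_bounded[of \<eta>] arcsin_le_arcsin[of 0 \<eta>] by (intro arccos_cos) auto
    finally show ?thesis .
  qed
  have metric_R: "sl2_metric p W (R z \<tau>) = N * (x * W $ 1 + z * W $ 2) / (\<rho> * N\<^sup>2)"
    if "p = vector [x, z, 0]" "z\<^sup>2 = y\<^sup>2" for p W z
    using sl2_metric_radial[of p W "N / \<rho>"] that by (simp add: R_def \<tau> N mult.commute)
  have norm_R: "sl2_metric p (R z \<tau>) (R z \<tau>) = 1" if "p = vector [x, z, 0]" "z\<^sup>2 = y\<^sup>2" for p z
  proof -
    have "x * R z \<tau> $ 1 + z * R z \<tau> $ 2 = N * (x\<^sup>2 + z\<^sup>2) / \<rho>"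
      by (simp add: R_def \<tau> power2_eq_square add_divide_distrib algebra_simps)
    also have "\<dots> = N * \<rho>"
      unfolding that(2) \<rho>(1)[symmetric] using \<rho>(2) by (simp add: power2_eq_square)
    finally show ?thesis
      unfolding metric_R[OF that] using \<rho>(2) N(2) by (simp add: power2_eq_square)
  qed
  define \<omega> where "\<omega> = arccos (\<nu> * \<eta> / E)"
  have base2: "angle_between sl2_metric (subarc c (- 1) 1) (subarc (r (- y)) \<tau> 0) = \<omega>"
  proof -
    have "x * V (- 1) $ 1 + - y * V (- 1) $ 2 = N * (\<nu> * - y)"
      using rad[of "- 1"] by (simp add: cT N_def)
    then have "sl2_metric (c (- 1)) (V (- 1)) (R (- y) \<tau>) = - (\<nu> * \<eta>)"
      using metric_R[OF cT(2), of "V (- 1)"] N(2) by (simp add: \<eta>_def power2_eq_square)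
    then show ?thesis
      unfolding angle_between_subarc[OF c r2] using \<tau> norm_R[OF cT(2)] speed
      by (simp add: \<omega>_def E_def)
  qed
  have base3: "angle_between sl2_metric (subarc (r y) \<tau> 0) (subarc c 1 (- 1)) = \<omega>"
  proof -
    have "x * V 1 $ 1 + y * V 1 $ 2 = N * (\<nu> * y)"
      using rad[of 1] by (simp add: cT N_def)
    then have "sl2_metric (c 1) (R y \<tau>) (V 1) = \<nu> * \<eta>"
      using metric_R[OF cT(1), of "V 1"] N(2) sl2_metric_sym[of "c 1" "R y \<tau>" "V 1"]
      by (simp add: \<eta>_def power2_eq_square)
    moreover have "r y \<tau> = c 1"
      by (simp add: r0 cT)
    ultimately show ?thesis
      unfolding angle_between_subarc[OF r1 c] using \<tau> norm_R[OF cT(1)] speed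
      by (simp add: \<omega>_def E_def)
  qed
  have "\<omega> < arccos \<eta>"
  proof -
    \<comment> \<open>Cauchy-Schwarz; needed because \<open>arccos\<close> is unspecified outside \<open>[-1, 1]\<close>\<close>
    have "\<nu> * \<eta> / E \<le> 1"
    proof -
      define V1 V2 where "V1 = V 1 $ 1" and "V2 = V 1 $ 2"
      have "N\<^sup>2 * (\<nu> * y)\<^sup>2 = (x * V1 + y * V2)\<^sup>2"
        using rad[of 1] by (simp add: cT N_def V1_def V2_def power_mult_distrib)
      also have "\<dots> \<le> \<rho>\<^sup>2 * (V1\<^sup>2 + V2\<^sup>2)"
      proof -
        have "\<rho>\<^sup>2 * (V1\<^sup>2 + V2\<^sup>2) - (x * V1 + y * V2)\<^sup>2 = (x * V2 - y * V1)\<^sup>2"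
          unfolding \<rho> by algebra
        then show ?thesis
          by (smt (verit) zero_le_power2)
      qed
      also have "\<dots> \<le> \<rho>\<^sup>2 * (N\<^sup>2 * E\<^sup>2)"
      proof (rule mult_left_mono)
        let ?\<alpha> = "sl2_form (c 1) (V 1)"
        have "E\<^sup>2 = (V1\<^sup>2 + V2\<^sup>2 + (1 + N\<^sup>2) * ?\<alpha>\<^sup>2) / N\<^sup>2 + (V 1 $ 3 + ?\<alpha>)\<^sup>2"
          unfolding E(3) speed[of 1, symmetric] sl2_metric_def N(1)
          by (simp add: cT V1_def V2_def power2_eq_square add_ac mult_ac)
        also have "\<dots> \<ge> (V1\<^sup>2 + V2\<^sup>2) / N\<^sup>2"
          by (simp add: add_divide_distrib)
        finally show "V1\<^sup>2 + V2\<^sup>2 \<le> N\<^sup>2 * E\<^sup>2"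
          using N(2) by (simp add: field_simps)
      qed simp
      finally have "(\<nu> * y)\<^sup>2 \<le> (\<rho> * E)\<^sup>2"
        using N(2) by (simp add: power_mult_distrib mult.left_commute)
      then have "\<nu> * y \<le> \<rho> * E"
        by (rule power2_le_imp_le) (use \<rho>(2) E(1) in simp)
      then show ?thesis
        using \<rho>(2) E(1) by (simp add: \<eta>_def field_simps)
    qed
    moreover have "\<eta> < \<nu> * \<eta> / E"
      using \<eta> E by (simp add: field_simps)
    ultimately show ?thesis
      unfolding \<omega>_def using \<eta> by (intro arccos_less_arccos) auto
  qed
  also have "arccos \<eta> = pi / 2 - arcsin \<eta>"
    using \<eta> by (simp add: arccos_arcsin_eq)
  finally have "2 * arcsin \<eta> + \<omega> + \<omega> < pi"
    by simp
  then have "interior_angle_sum sl2_metric (subarc (r (- y)) 0 \<tau>) (subarc c (- 1) 1) (subarc (r y) \<tau> 0) < pi"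
    unfolding interior_angle_sum_def reversepath_subarc apex base2 base3 .
  moreover have "geodesic_triangle sl2_metric 0 (vector [x, - y, 0]) (vector [x, y, 0])
      (subarc (r (- y)) 0 \<tau>) (subarc c (- 1) 1) (subarc (r y) \<tau> 0)"
    unfolding geodesic_triangle_def
    using geodesic_segment_subarc[OF r1] geodesic_segment_subarc[OF r2] geodesic_segment_subarc[OF c]
      r0 cT xy not_on_common_geodesic_origin[of "vector [x, - y, 0]" "vector [x, y, 0]"]
    by (auto simp: vec_eq_iff forall_3)
  ultimately show ?thesis
    by blast
qed

theorem theorem4p4:
  shows "(\<exists>A1 A2 A3 c12 c23 c31.
            geodesic_triangle sl2_metric A1 A2 A3 c12 c23 c31 \<and>
            interior_angle_sum sl2_metric c12 c23 c31 > pi) \<and>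
         (\<exists>A1 A2 A3 c12 c23 c31.
            geodesic_triangle sl2_metric A1 A2 A3 c12 c23 c31 \<and>
            interior_angle_sum sl2_metric c12 c23 c31 < pi) \<and>
         (\<exists>A1 A2 A3 c12 c23 c31.
            geodesic_triangle sl2_metric A1 A2 A3 c12 c23 c31 \<and>
            interior_angle_sum sl2_metric c12 c23 c31 = pi)"
  using triangle_sum_greater triangle_sum_less triangle_sum_equal by blast

end
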